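(* Let $n\ge 1$, let $N$ and $V$ be finite disjoint sets with $|N|=|V|=n$, and let $Q\subseteq\mathbb{R}^{n^3}$ be the polyhedron of achievable probabilities. For every $J\subseteq V$ with $|J|=h$, $2\le h\le n-1$, every $I\subseteq N$ with $|I|=r\in[n-1]$, every $t\in[n-h]$, and every $i_t,i_{t+1},\dots,i_{t+h-2}\in N$ (repetitions allowed), the inequality $$r\sum_{\tau=t+h}^{n}Z_{N,J}^{\tau}+n\,Z_{I,J}^{t+h-1}+\sum_{\tau=t}^{t+h-2}n^{t+h-\tau}Z_{i_\tau,J}^{\tau}\le r+\sum_{\tau=1}^{h-1}n^{\tau}$$ is facet-defining for $Q$.
   Context: $[n]=\{1,\dots,n\}$; singletons are identified with their element. For $I\subseteq N$, $J\subseteq V$, $t\in[n]$: $Z_{I,J}^t:=\sum_{i\in I}\sum_{j\in J}z_{ij}^t$. Online bipartite matching model: $N$ is the set of impression types, $V$ the set of ads, $|N|=|V|=n$, and there are $n$ stages, counted down $t=n,n-1,\dots,1$ (stage $n$ is first; $t$ is the number of remaining decision epochs including the current one). At each stage an impression type is drawn independently and uniformly from $N$ and must be immediately and irrevocably matched to a still-available ad of $V$ or discarded; each ad is matched at most once. All pairs in $N\times V$ may be matched. Polyhedron of achievable probabilities $Q$. Consider nonnegative variables $x_{i,j}^{t,S}$ for $t\in[n]$, $i\in N$, $j\in V$, $S\subseteq V\setminus j$ with $|S|\ge t-1$ (probability that in stage $t$ type $i$ appears, the available ads are $S\cup j$, and $i$ is matched to $j$), and $y_i^{t,S}$ for $t\in[n]$,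 $i\in N$, $S\subseteq V$ with $|S|\ge t$ (probability that in stage $t$ type $i$ appears, the available ads are $S$, and $i$ is discarded), subject to (a) $\sum_{j\in V}x_{i,j}^{n,V\setminus j}+y_i^{n,V}\le \frac1n$ for $i\in N$; (b) $\sum_{j\in S}x_{i,j}^{t,S\setminus j}+y_i^{t,S}1_{\{t\ne1\}}-\frac1n 1_{\{|S|>t\}}\sum_{k\in N}y_k^{t+1,S}-\frac1n\sum_{k\in N}\sum_{j\in V\setminus S}x_{k,j}^{t+1,S}\le 0$ for $t\in[n-1]$, $i\in N$, $\emptyset\ne S\subsetneq V$ with $|S|\ge t$; (c) $\sum_{j\in V}x_{i,j}^{t,V\setminus j}+y_i^{t,V}1_{\{t\ne1\}}-\frac1n\sum_{k\in N}y_k^{t+1,V}\le0$ for $t\in[n-1]$, $i\in N$. Here $1_{\mathcal A}$ is $1$ if condition $\mathcal A$ holds and $0$ otherwise. $Q$ is the set of $z=(z_{ij}^t)_{i\in N,j\in V,t\in[n]}\in\mathbb{R}^{n^3}$ for which there is a feasible $(x,y)\ge0$ with $z_{ij}^t=\sum_{S}x_{i,j}^{t,S}$ (sum over $S\subseteq V\setminus j$ with $|S|\ge t-1$). Thus $z_{ij}^t$ is the probability that impression type $i$ is matched to ad $j$ in stage $t$ under some feasible policy. $Q$ is full-dimensional in $\mathbb{R}^{n^3}$. An inequality is facet-defining for $Q$ if it is valid for $Q$ and the set of points of $Q$ satisfying it with equality has dimension $n^3-1$. *)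

theory Defs
  imports "HOL-Analysis.Analysis"
begin

(* The impression types N and the ads V are the universes of two finite types 'i and 'j
   (distinct types, hence disjoint) with CARD('i) = CARD('j) = n.  The stages form a copy
   of {1..n} with n = CARD('i), so that R^(n^3) is the Euclidean space
   real ^ ('i \<times> 'j \<times> 'i stage). *)

typedef 'a stage = "{1..CARD('a::finite)}"
proof
  show "CARD('a) \<in> {1..CARD('a)}"
    by (simp add: Suc_leI)
qed

instance stage :: (finite) finite
proof
  have "(UNIV :: 'a stage set) = Abs_stage ` {1..CARD('a)}"
    using type_definition.Abs_image[OF type_definition_stage] by (rule sym)
  then show "finite (UNIV :: 'a stage set)"
    by (metis finite_atLeastAtMost finite_imageI)
qed

lemma card_stage: "CARD('a::finite stage) = CARD('a)"
  using type_definition.card[OF type_definition_stage] by simp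

(* The coordinate of z for type i, ad j, stage t; only used for 1 \<le> t \<le> n. *)
definition coord ::
  "real ^ ('i::finite \<times> 'j::finite \<times> 'i stage) \<Rightarrow> 'i \<Rightarrow> 'j \<Rightarrow> nat \<Rightarrow> real"
  where "coord z i j t = z $ (i, j, Abs_stage t)"

definition Zsum ::
  "real ^ ('i::finite \<times> 'j::finite \<times> 'i stage) \<Rightarrow> 'i set \<Rightarrow> 'j set \<Rightarrow> nat \<Rightarrow> real"
  where "Zsum z I J t = (\<Sum>i\<in>I. \<Sum>j\<in>J. coord z i j t)"

(* x t i j S and y t i S are total functions, but only their values at the following
   indices are variables of the system; no other value is constrained or used. *)
definition x_index :: "nat \<Rightarrow> nat \<Rightarrow> 'j \<Rightarrow> 'j set \<Rightarrow> bool"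
  where "x_index n t j S \<longleftrightarrow> t \<in> {1..n} \<and> S \<subseteq> UNIV - {j} \<and> t - 1 \<le> card S"

definition y_index :: "nat \<Rightarrow> nat \<Rightarrow> 'j set \<Rightarrow> bool"
  where "y_index n t S \<longleftrightarrow> t \<in> {1..n} \<and> t \<le> card S"

definition feasible_policy ::
  "(nat \<Rightarrow> 'i::finite \<Rightarrow> 'j::finite \<Rightarrow> 'j set \<Rightarrow> real) \<Rightarrow> (nat \<Rightarrow> 'i \<Rightarrow> 'j set \<Rightarrow> real) \<Rightarrow> bool"
  where
  "feasible_policy x y \<longleftrightarrow> (let n = CARD('i) in
     (\<forall>t i j S. x_index n t j S \<longrightarrow> 0 \<le> x t i j S) \<and>
     (\<forall>t i S. y_index n t S \<longrightarrow> 0 \<le> y t i S) \<and>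
     (\<forall>i. (\<Sum>j\<in>UNIV. x n i j (UNIV - {j})) + y n i UNIV \<le> 1 / real n) \<and>
     (\<forall>t\<in>{1..n-1}. \<forall>i S. S \<noteq> {} \<and> S \<subset> UNIV \<and> t \<le> card S \<longrightarrow>
        (\<Sum>j\<in>S. x t i j (S - {j})) + y t i S * of_bool (t \<noteq> 1)
        - 1 / real n * of_bool (t < card S) * (\<Sum>k\<in>UNIV. y (t + 1) k S)
        - 1 / real n * (\<Sum>k\<in>UNIV. \<Sum>j\<in>UNIV - S. x (t + 1) k j S) \<le> 0) \<and>
     (\<forall>t\<in>{1..n-1}. \<forall>i.
        (\<Sum>j\<in>UNIV. x t i j (UNIV - {j})) + y t i UNIV * of_bool (t \<noteq> 1)
        - 1 / real n * (\<Sum>k\<in>UNIV. y (t + 1) k UNIV) \<le> 0))"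

definition achievable :: "(real ^ ('i::finite \<times> 'j::finite \<times> 'i stage)) set"
  where
  "achievable = {z. \<exists>x y. feasible_policy x y \<and>
     (\<forall>i j. \<forall>t\<in>{1..CARD('i)}.
        coord z i j t = (\<Sum>S\<in>{S. S \<subseteq> UNIV - {j} \<and> t - 1 \<le> card S}. x t i j S))}"

(* The inequality f z \<le> b (f a linear form) is facet-defining for P. *)
definition facet_defining ::
  "(real ^ ('i::finite \<times> 'j::finite \<times> 'i stage)) set \<Rightarrow>
   (real ^ ('i \<times> 'j \<times> 'i stage) \<Rightarrow> real) \<Rightarrow> real \<Rightarrow> bool"
  where
  "facet_defining P f b \<longleftrightarrow>
     (\<forall>z\<in>P. f z \<le> b) \<and> aff_dim {z \<in> P. f z = b} = int (CARD('i) ^ 3) - 1"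

end

theory Submission
  imports Defs
begin

text \<open>
  Read the left-hand side as the expected reward of a policy. With \<open>s\<close> stages to go and \<open>k\<close> ads of
  \<open>J\<close> left, the optimal expected reward is \<open>c 0 + \<dots> + c (min k (s + 1 - t) - 1)\<close> for the decreasing
  sequence \<open>c = (n^(h-1), \<dots>, n, r)\<close>. These values form a feasible dual solution, whence validity.

  For the dimension, let \<open>a\<close> be a linear functional that is constant on the face. Then \<open>a\<close> has the same
  value on all optimal continuations from every state that optimal play can reach, so that two optimal
  decisions in such a state are worth the same under \<open>a\<close>. In a state with \<open>min (s - t) h\<close> ads of \<open>J\<close>
  left, both discarding and matching a rewarded type to \<open>J\<close> are optimal; comparing them expresses
  \<open>a\<close> at stage \<open>s\<close> through \<open>a\<close> at a stage of smaller index, and determines \<open>a\<close> up to a factor.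
\<close>

section \<open>Weak duality\<close>

text \<open>The set left after matching j corresponds to the set with j put back. This turns a sum
  over states entered into one over states left.\<close>

lemma sum_over_removed_ad:
  fixes g :: "'j::finite \<Rightarrow> 'j set \<Rightarrow> real"
  assumes "1 \<le> s"
  shows "(\<Sum>S\<in>{S. s - 1 \<le> card S}. \<Sum>j\<in>UNIV - S. g j S)
       = (\<Sum>S\<in>{S. s \<le> card S}. \<Sum>j\<in>S. g j (S - {j}))"
proof -
  have "(\<Sum>(S, j)\<in>Sigma {S. s - 1 \<le> card S} (\<lambda>S. UNIV - S). g j S)
      = (\<Sum>(S, j)\<in>Sigma {S. s \<le> card S} (\<lambda>S. S). g j (S - {j}))"
    using assms
    by (intro sum.reindex_bij_witness[where i = "\<lambda>(S, j). (S - {j}, j)"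
            and j = "\<lambda>(S, j). (insert j S, j)"])
       (auto simp: insert_absorb card_insert_if)
  then show ?thesis
    by (simp add: sum.Sigma)
qed

lemma sum_over_ad_then_set:
  fixes g :: "'j::finite \<Rightarrow> 'j set \<Rightarrow> real"
  shows "(\<Sum>j\<in>UNIV. \<Sum>S\<in>{S. S \<subseteq> UNIV - {j} \<and> m \<le> card S}. g j S)
       = (\<Sum>S\<in>{S. m \<le> card S}. \<Sum>j\<in>UNIV - S. g j S)"
proof -
  have "(\<Sum>(j, S)\<in>Sigma UNIV (\<lambda>j. {S. S \<subseteq> UNIV - {j} \<and> m \<le> card S}). g j S)
      = (\<Sum>(S, j)\<in>Sigma {S. m \<le> card S} (\<lambda>S. UNIV - S). g j S)"
    by (intro sum.reindex_bij_witness[where i = "\<lambda>(S, j). (j, S)" and j = "\<lambda>(j, S). (S, j)"]) auto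
  then show ?thesis
    by (simp add: sum.Sigma)
qed

text \<open>\<open>\<Phi> s S\<close> acts as the dual price of a state and \<open>B s i S\<close>
  as its price once type i has appeared. No decision earns more than \<open>B\<close>, and
  \<open>B\<close> averages to at most \<open>\<Phi>\<close>. So the reward of a stage is at most
  the drop in the total price of the mass, and the sum over stages telescopes.\<close>

lemma weak_duality:
  fixes x :: "nat \<Rightarrow> 'i::finite \<Rightarrow> 'j::finite \<Rightarrow> 'j set \<Rightarrow> real"
    and \<Phi> :: "nat \<Rightarrow> 'j set \<Rightarrow> real" and w :: "nat \<Rightarrow> 'i \<Rightarrow> 'j \<Rightarrow> real"
  defines "n \<equiv> CARD('i)"
  assumes feas: "feasible_policy x y" and card_j: "CARD('j) = n"
    and nonneg: "\<And>s S. 0 \<le> \<Phi> s S" and final: "\<And>S. \<Phi> 0 S = 0"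
    and discard: "\<And>s i S. s \<in> {1..n} \<Longrightarrow> \<Phi> (s - 1) S \<le> B s i S"
    and match: "\<And>s i S j. s \<in> {1..n} \<Longrightarrow> j \<in> S \<Longrightarrow> w s i j + \<Phi> (s - 1) (S - {j}) \<le> B s i S"
    and average: "\<And>s S. s \<in> {1..n} \<Longrightarrow> (\<Sum>i\<in>UNIV. B s i S) \<le> real n * \<Phi> s S"
  shows "(\<Sum>s=1..n. \<Sum>i\<in>UNIV. \<Sum>j\<in>UNIV. w s i j *
            (\<Sum>S\<in>{S. S \<subseteq> UNIV - {j} \<and> s - 1 \<le> card S}. x s i j S)) \<le> \<Phi> n UNIV"
proof -
  have n1: "1 \<le> n"
    by (simp add: n_def Suc_leI)
  have xnn: "\<And>s i j S. s \<in> {1..n} \<Longrightarrow> j \<notin> S \<Longrightarrow> s - 1 \<le> card S \<Longrightarrow> 0 \<le> x s i j S"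
    and ynn: "\<And>s i S. s \<in> {1..n} \<Longrightarrow> s \<le> card S \<Longrightarrow> 0 \<le> y s i S"
    and ca: "\<And>i. (\<Sum>j\<in>UNIV. x n i j (UNIV - {j})) + y n i UNIV \<le> 1 / real n"
    and cb: "\<And>s i S. s \<in> {1..n-1} \<Longrightarrow> S \<noteq> {} \<Longrightarrow> S \<subset> UNIV \<Longrightarrow> s \<le> card S \<Longrightarrow>
        (\<Sum>j\<in>S. x s i j (S - {j})) + y s i S * of_bool (s \<noteq> 1)
        - 1 / real n * of_bool (s < card S) * (\<Sum>k\<in>UNIV. y (s + 1) k S)
        - 1 / real n * (\<Sum>k\<in>UNIV. \<Sum>j\<in>UNIV - S. x (s + 1) k j S) \<le> 0"
    and cc: "\<And>s i. s \<in> {1..n-1} \<Longrightarrow>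
        (\<Sum>j\<in>UNIV. x s i j (UNIV - {j})) + y s i UNIV * of_bool (s \<noteq> 1)
        - 1 / real n * (\<Sum>k\<in>UNIV. y (s + 1) k UNIV) \<le> 0"
    using feas by (simp_all add: feasible_policy_def Let_def x_index_def y_index_def n_def
        subset_Diff_insert)
  \<comment> \<open>The mass entering state S at stage s: one formula for the right-hand sides of
    (a), (b) and (c). For S = \<open>UNIV\<close> the last sum is empty, as in (c).\<close>
  define P where "P s S = (if s = n then of_bool (S = UNIV) else
      of_bool (s < card S) * (\<Sum>k\<in>UNIV. y (s + 1) k S)
      + (\<Sum>k\<in>UNIV. \<Sum>j\<in>UNIV - S. x (s + 1) k j S))" for s S
  have balance: "(\<Sum>j\<in>S. x s i j (S - {j})) + y s i S * of_bool (s \<noteq> 1) \<le> P s S / real n"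
    if s: "s \<in> {1..n}" and S: "s \<le> card S" for s i S
  proof (cases "s = n")
    case True
    with S card_j have "S = UNIV"
      using card_seteq[OF finite subset_UNIV, of S] by simp
    with True show ?thesis
      using ca[of i] ynn[of n UNIV i] n1 card_j by (auto simp: P_def)
  next
    case False
    with s have s': "s \<in> {1..n-1}" "s < n"
      by auto
    show ?thesis
    proof (cases "S = UNIV")
      case True
      then show ?thesis
        using cc[OF s'(1), of i] s' False card_j by (simp add: P_def)
    next
      case f: False
      have "S \<noteq> {}"
        using S s by auto
      moreover have "S \<subset> UNIV"
        using f by blast
      ultimately show ?thesis
        using cb[OF s'(1) _ _ S, of i] False
        by (simp add: P_def algebra_simps add_divide_distrib del: of_bool_eq_1_iff of_bool_eq_0_iff split del: split_of_bool)
    qed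
  qed
  define R where "R s = (\<Sum>i\<in>UNIV. \<Sum>j\<in>UNIV. w s i j *
      (\<Sum>S\<in>{S. S \<subseteq> UNIV - {j} \<and> s - 1 \<le> card S}. x s i j S))" for s
  \<comment> \<open>The potential that telescopes: the mass present at stage s, priced by
    \<open>\<Phi>\<close>.\<close>
  define T where "T s = (\<Sum>S\<in>{S. s \<le> card S}. \<Phi> s S * P s S)" for s
  have step: "R s + T (s - 1) \<le> T s" if s: "s \<in> {1..n}" for s
  proof -
    have s1: "1 \<le> s"
      using s by simp
    have R_eq: "R s = (\<Sum>S\<in>{S. s \<le> card S}. \<Sum>i\<in>UNIV. \<Sum>j\<in>S. w s i j * x s i j (S - {j}))"
      unfolding R_def sum_distrib_left sum_over_ad_then_set sum_over_removed_ad[OF s1]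
      by (rule sum.swap)
    \<comment> \<open>Mass enters stage s - 1 by a discard (same set) or a match (one ad fewer);
      both parts are rewritten over the sets of stage s.\<close>
    have "T (s - 1) = (\<Sum>S\<in>{S. s - 1 \<le> card S}. of_bool (s \<le> card S) * (\<Sum>i\<in>UNIV. \<Phi> (s - 1) S * y s i S))
        + (\<Sum>S\<in>{S. s - 1 \<le> card S}. \<Sum>i\<in>UNIV. \<Sum>j\<in>UNIV - S. \<Phi> (s - 1) S * x s i j S)"
      using s unfolding T_def sum.distrib[symmetric]
      by (intro sum.cong) (auto simp: P_def sum_distrib_left algebra_simps)
    also have "(\<Sum>S\<in>{S. s - 1 \<le> card S}. of_bool (s \<le> card S) * (\<Sum>i\<in>UNIV. \<Phi> (s - 1) S * y s i S))
        = (\<Sum>S\<in>{S. s \<le> card S}. \<Sum>i\<in>UNIV. \<Phi> (s - 1) S * y s i S)"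
      by (rule sum.mono_neutral_cong_right) auto
    also have "(\<Sum>S\<in>{S. s - 1 \<le> card S}. \<Sum>i\<in>UNIV. \<Sum>j\<in>UNIV - S. \<Phi> (s - 1) S * x s i j S)
        = (\<Sum>i\<in>UNIV. \<Sum>S\<in>{S. s - 1 \<le> card S}. \<Sum>j\<in>UNIV - S. \<Phi> (s - 1) S * x s i j S)"
      by (rule sum.swap)
    also have "\<dots> = (\<Sum>S\<in>{S. s \<le> card S}. \<Sum>i\<in>UNIV. \<Sum>j\<in>S. \<Phi> (s - 1) (S - {j}) * x s i j (S - {j}))"
      unfolding sum_over_removed_ad[OF s1] by (rule sum.swap)
    finally have T_eq: "T (s - 1) = (\<Sum>S\<in>{S. s \<le> card S}. \<Sum>i\<in>UNIV. \<Phi> (s - 1) S * y s i S)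
        + (\<Sum>S\<in>{S. s \<le> card S}. \<Sum>i\<in>UNIV. \<Sum>j\<in>S. \<Phi> (s - 1) (S - {j}) * x s i j (S - {j}))" .
    have "R s + T (s - 1) = (\<Sum>S\<in>{S. s \<le> card S}. \<Sum>i\<in>UNIV.
        (\<Sum>j\<in>S. (w s i j + \<Phi> (s - 1) (S - {j})) * x s i j (S - {j})) + \<Phi> (s - 1) S * y s i S)"
      unfolding R_eq T_eq by (simp add: sum.distrib algebra_simps)
    also have "\<dots> \<le> (\<Sum>S\<in>{S. s \<le> card S}. \<Phi> s S * P s S)"
    proof (rule sum_mono)
      fix S assume "S \<in> {S :: 'j set. s \<le> card S}"
      then have S: "s \<le> card S"
        by simp
      have Bnn: "0 \<le> B s i S" for i
        using nonneg discard[OF s] order_trans by blast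
      have 1: "(\<Sum>j\<in>S. (w s i j + \<Phi> (s - 1) (S - {j})) * x s i j (S - {j})) + \<Phi> (s - 1) S * y s i S
          \<le> B s i S * (P s S / real n)" for i
      proof -
        have "(\<Sum>j\<in>S. (w s i j + \<Phi> (s - 1) (S - {j})) * x s i j (S - {j}))
            \<le> (\<Sum>j\<in>S. B s i S * x s i j (S - {j}))"
          using match[OF s] xnn[OF s] S by (intro sum_mono mult_right_mono) auto
        \<comment> \<open>For s = 1 the right-hand side is 0, and so is the left-hand side because
          \<open>\<Phi> 0 S = 0\<close>.\<close>
        moreover have "\<Phi> (s - 1) S * y s i S \<le> B s i S * (y s i S * of_bool (s \<noteq> 1))"
          using discard[OF s, of S i] ynn[OF s S, of i] final by (auto intro: mult_right_mono)
        ultimately have "(\<Sum>j\<in>S. (w s i j + \<Phi> (s - 1) (S - {j})) * x s i j (S - {j})) + \<Phi> (s - 1) S * y s i S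
            \<le> B s i S * ((\<Sum>j\<in>S. x s i j (S - {j})) + y s i S * of_bool (s \<noteq> 1))"
          by (simp add: distrib_left sum_distrib_left)
        also have "\<dots> \<le> B s i S * (P s S / real n)"
          using balance[OF s S] Bnn by (intro mult_left_mono)
        finally show ?thesis .
      qed
      have Pnn: "0 \<le> P s S"
      proof -
        \<comment> \<open>The balance of any single type suffices; \<open>undefined\<close> is an
          arbitrary one.\<close>
        have "0 \<le> (\<Sum>j\<in>S. x s undefined j (S - {j})) + y s undefined S * of_bool (s \<noteq> 1)"
          using xnn[OF s] ynn[OF s S] S by (intro add_nonneg_nonneg sum_nonneg mult_nonneg_nonneg) auto
        also note balance[OF s S]
        finally show ?thesis
          using n1 by (simp add: zero_le_divide_iff)
      qed
      have "(\<Sum>i\<in>UNIV. (\<Sum>j\<in>S. (w s i j + \<Phi> (s - 1) (S - {j})) * x s i j (S - {j})) + \<Phi> (s - 1) S * y s i S)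
          \<le> (\<Sum>i\<in>UNIV. B s i S * (P s S / real n))"
        by (intro sum_mono 1)
      also have "\<dots> = (\<Sum>i\<in>UNIV. B s i S) * (P s S / real n)"
        by (rule sum_distrib_right[symmetric])
      also have "\<dots> \<le> real n * \<Phi> s S * (P s S / real n)"
        using Pnn by (intro mult_right_mono average[OF s]) auto
      also have "\<dots> = \<Phi> s S * P s S"
        using n1 by simp
      finally show "(\<Sum>i\<in>UNIV. (\<Sum>j\<in>S. (w s i j + \<Phi> (s - 1) (S - {j})) * x s i j (S - {j})) + \<Phi> (s - 1) S * y s i S)
          \<le> \<Phi> s S * P s S" .
    qed
    finally show ?thesis
      by (simp add: T_def)
  qed
  have "(\<Sum>s=1..m. R s) \<le> T m" if "m \<le> n" for m
    using that
  proof (induction m)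
    case 0
    then show ?case
      by (simp add: T_def final)
  next
    case (Suc m)
    then show ?case
      using step[of "Suc m"] by simp
  qed
  also have "T n = \<Phi> n UNIV"
  proof -
    have "{S :: 'j set. n \<le> card S} = {UNIV}"
      using card_j card_seteq[OF finite subset_UNIV] by (auto simp del: UNIV_I)
    then show ?thesis
      by (simp add: T_def P_def)
  qed
  finally show ?thesis
    by (simp add: R_def)
qed

section \<open>Outcomes of policies\<close>

fun remaining :: "'j set \<Rightarrow> 'j option \<Rightarrow> 'j set" where
  "remaining S None = S"
| "remaining S (Some j) = S - {j}"

text \<open>
  \<open>outcome s S z\<close>: some history-dependent policy started with \<open>s\<close> stages to go and available ads \<open>S\<close>
  has matching probabilities \<open>z\<close>. In a step, \<open>d k\<close> is the decision for type \<open>k\<close> and \<open>z k\<close> the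
  outcome of the continuation.
\<close>
inductive outcome :: "nat \<Rightarrow> 'j set \<Rightarrow> (nat \<Rightarrow> 'i::finite \<Rightarrow> 'j \<Rightarrow> real) \<Rightarrow> bool" where
  stop: "outcome 0 S (\<lambda>_ _ _. 0)"
| step: "\<lbrakk>\<And>k. set_option (d k) \<subseteq> S; \<And>k. outcome s (remaining S (d k)) (z k)\<rbrakk> \<Longrightarrow>
    outcome (Suc s) S (\<lambda>\<tau> i j. (of_bool (\<tau> = Suc s \<and> d i = Some j) + (\<Sum>k\<in>UNIV. z k \<tau> i j)) / real CARD('i))"

lemma outcome_mono:
  assumes "outcome s S z" and "S \<subseteq> S'"
  shows "outcome s S' z"
  using assms
proof (induction arbitrary: S' rule: outcome.induct)
  case (stop S)
  show ?case
    by (rule outcome.stop)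
next
  case (step d S s z)
  have "remaining S (d k) \<subseteq> remaining S' (d k)" for k
    using step.prems by (cases "d k") auto
  then show ?case
    using step by (intro outcome.step) blast+
qed

text \<open>Solutions \<open>(x, y)\<close> of the system started at stage \<open>T\<close> with unit mass at the ad set \<open>S0\<close>. The support
  conditions make the truncations in the system (cardinality bounds, indicators) automatic.\<close>
definition flow ::
  "nat \<Rightarrow> 'j::finite set \<Rightarrow> (nat \<Rightarrow> 'i::finite \<Rightarrow> 'j \<Rightarrow> 'j set \<Rightarrow> real) \<Rightarrow> (nat \<Rightarrow> 'i \<Rightarrow> 'j set \<Rightarrow> real) \<Rightarrow> bool"
  where "flow T S0 x y \<longleftrightarrow>
    (\<forall>s i j S. 0 \<le> x s i j S \<and> (x s i j S \<noteq> 0 \<longrightarrow> s \<le> T \<and> s \<le> Suc (card S))) \<and>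
    (\<forall>s i S. 0 \<le> y s i S \<and> (y s i S \<noteq> 0 \<longrightarrow> s \<le> T \<and> s \<le> card S)) \<and>
    (\<forall>s i S. 1 \<le> s \<longrightarrow> (\<Sum>j\<in>S. x s i j (S - {j})) + y s i S \<le>
       (of_bool (s = T \<and> S = S0) + (\<Sum>k\<in>UNIV. y (Suc s) k S)
         + (\<Sum>k\<in>UNIV. \<Sum>j\<in>UNIV - S. x (Suc s) k j S)) / real CARD('i))"

text \<open>The flow of a step is the average over the first types k of the flows of their
  continuations, plus mass 1/n on each first decision. A stage uses at most one ad, so s \<le> card
  S keeps all visited sets large enough for the support conditions.\<close>

lemma outcome_flow:
  fixes z :: "nat \<Rightarrow> 'i::finite \<Rightarrow> 'j::finite \<Rightarrow> real"
  assumes "outcome s S z" and "s \<le> card S"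
  shows "\<exists>x y. flow s S x y \<and>
    (\<forall>\<tau> i j. 1 \<le> \<tau> \<longrightarrow> z \<tau> i j = (\<Sum>R\<in>{R. R \<subseteq> UNIV - {j} \<and> \<tau> - 1 \<le> card R}. x \<tau> i j R))"
  using assms
proof (induction rule: outcome.induct)
  case (stop S)
  show ?case
    by (intro exI[of _ "\<lambda>_ _ _ _. 0"] exI[of _ "\<lambda>_ _ _. 0"]) (simp add: flow_def)
next
  case (step d S s z)
  let ?n = "real CARD('i)"
  have card_rem: "s \<le> card (remaining S (d k))" for k
    using step.prems by (cases "d k") (auto simp: card_Diff_singleton_if)
  have "\<forall>k. \<exists>x y. flow s (remaining S (d k)) x y \<and> (\<forall>\<tau> i j. 1 \<le> \<tau> \<longrightarrow>
      z k \<tau> i j = (\<Sum>R\<in>{R. R \<subseteq> UNIV - {j} \<and> \<tau> - 1 \<le> card R}. x \<tau> i j R))"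
    using step.IH[OF card_rem] by blast
  then obtain X Y where fl: "\<And>k. flow s (remaining S (d k)) (X k) (Y k)"
    and zX: "\<And>k \<tau> i j. 1 \<le> \<tau> \<Longrightarrow>
      z k \<tau> i j = (\<Sum>R\<in>{R. R \<subseteq> UNIV - {j} \<and> \<tau> - 1 \<le> card R}. X k \<tau> i j R)"
    unfolding choice_iff by blast
  \<comment> \<open>The first decisions alone, before division by n: unit mass per type.\<close>
  define dx where "dx \<tau> i j R = (of_bool (\<tau> = Suc s \<and> d i = Some j \<and> R = S - {j}) :: real)" for \<tau> i j R
  define dy where "dy \<tau> i R = (of_bool (\<tau> = Suc s \<and> d i = None \<and> R = S) :: real)" for \<tau> i R
  define x where "x \<tau> i j R = (dx \<tau> i j R + (\<Sum>k\<in>UNIV. X k \<tau> i j R)) / ?n" for \<tau> i j R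
  define y where "y \<tau> i R = (dy \<tau> i R + (\<Sum>k\<in>UNIV. Y k \<tau> i R)) / ?n" for \<tau> i R
  have Xnn: "0 \<le> X k \<tau> i j R" and X0: "\<not> (\<tau> \<le> s \<and> \<tau> \<le> Suc (card R)) \<Longrightarrow> X k \<tau> i j R = 0"
    and Ynn: "0 \<le> Y k \<tau> i R" and Y0: "\<not> (\<tau> \<le> s \<and> \<tau> \<le> card R) \<Longrightarrow> Y k \<tau> i R = 0" for k \<tau> i j R
    using fl[of k] unfolding flow_def by blast+
  have cons: "(\<Sum>j\<in>R. X k \<tau> i j (R - {j})) + Y k \<tau> i R \<le>
       (of_bool (\<tau> = s \<and> R = remaining S (d k)) + (\<Sum>l\<in>UNIV. Y k (Suc \<tau>) l R)
         + (\<Sum>l\<in>UNIV. \<Sum>j\<in>UNIV - R. X k (Suc \<tau>) l j R)) / ?n" if "1 \<le> \<tau>" for k \<tau> i R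
    using fl[of k] that unfolding flow_def by blast
  have dS: "d i = Some j \<Longrightarrow> j \<in> S" for i j
    using step.hyps(1)[of i] by auto
  have x0: "x \<tau> i j R = 0" if "\<not> (\<tau> \<le> Suc s \<and> \<tau> \<le> Suc (card R))" for \<tau> i j R
  proof -
    have "dx \<tau> i j R = 0"
      using that step.prems dS[of i j] by (auto simp: dx_def card_Diff_singleton_if)
    then show ?thesis
      using X0[of \<tau> R] that by (simp add: x_def)
  qed
  have y0: "y \<tau> i R = 0" if "\<not> (\<tau> \<le> Suc s \<and> \<tau> \<le> card R)" for \<tau> i R
  proof -
    have "dy \<tau> i R = 0"
      using that step.prems by (auto simp: dy_def)
    then show ?thesis
      using Y0[of \<tau> R] that by (simp add: y_def)
  qed
  \<comment> \<open>Each type makes exactly one first decision, so one unit leaves S.\<close>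
  have dbal: "(\<Sum>j\<in>R. dx \<tau> i j (R - {j})) + dy \<tau> i R = of_bool (\<tau> = Suc s \<and> R = S)" for \<tau> i R
  proof (cases "d i")
    case None
    then show ?thesis
      by (auto simp: dx_def dy_def)
  next
    case (Some j)
    have "(\<Sum>j'\<in>R. dx \<tau> i j' (R - {j'})) = (\<Sum>j'\<in>R. if j = j' then of_bool (\<tau> = Suc s \<and> R - {j} = S - {j}) else 0)"
      using Some by (intro sum.cong) (auto simp: dx_def)
    also have "\<dots> = of_bool (\<tau> = Suc s \<and> R = S)"
      using dS[OF Some] by (auto simp: sum.delta')
    finally show ?thesis
      using Some by (simp add: dy_def)
  qed
  \<comment> \<open>The unit sent by type i arrives exactly at the source of the flow
    \<open>X i\<close>, \<open>Y i\<close>, so it supplies the source term of that flow.\<close>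
  have dflow: "dy (Suc \<tau>) i R + (\<Sum>j\<in>UNIV - R. dx (Suc \<tau>) i j R) = of_bool (\<tau> = s \<and> R = remaining S (d i))" for \<tau> i R
  proof (cases "d i")
    case None
    then show ?thesis
      by (auto simp: dx_def dy_def)
  next
    case (Some j)
    have "(\<Sum>j'\<in>UNIV - R. dx (Suc \<tau>) i j' R) = (\<Sum>j'\<in>UNIV - R. if j = j' then of_bool (\<tau> = s \<and> R = S - {j}) else 0)"
      using Some by (intro sum.cong) (auto simp: dx_def)
    also have "\<dots> = of_bool (\<tau> = s \<and> R = S - {j})"
      by (auto simp: sum.delta')
    finally show ?thesis
      using Some by (simp add: dy_def)
  qed
  have "flow (Suc s) S x y"
    unfolding flow_def
  proof (intro conjI allI impI)
    show "0 \<le> x \<tau> i j R" for \<tau> i j R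
      using Xnn by (auto simp: x_def dx_def intro!: divide_nonneg_nonneg add_nonneg_nonneg sum_nonneg)
    show "0 \<le> y \<tau> i R" for \<tau> i R
      using Ynn by (auto simp: y_def dy_def intro!: divide_nonneg_nonneg add_nonneg_nonneg sum_nonneg)
    show "\<tau> \<le> Suc s" if "x \<tau> i j R \<noteq> 0" for \<tau> i j R
      using x0 that by blast
    show "\<tau> \<le> Suc (card R)" if "x \<tau> i j R \<noteq> 0" for \<tau> i j R
      using x0 that by blast
    show "\<tau> \<le> Suc s" if "y \<tau> i R \<noteq> 0" for \<tau> i R
      using y0 that by blast
    show "\<tau> \<le> card R" if "y \<tau> i R \<noteq> 0" for \<tau> i R
      using y0 that by blast
    fix \<tau> :: nat and i :: 'i and R :: "'j set" assume \<tau>: "1 \<le> \<tau>"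
    have "(\<Sum>j\<in>R. x \<tau> i j (R - {j})) + y \<tau> i R
       = (((\<Sum>j\<in>R. dx \<tau> i j (R - {j})) + dy \<tau> i R) + ((\<Sum>j\<in>R. \<Sum>k\<in>UNIV. X k \<tau> i j (R - {j})) + (\<Sum>k\<in>UNIV. Y k \<tau> i R))) / ?n"
      by (simp add: x_def y_def sum.distrib add_divide_distrib flip: sum_divide_distrib)
    also have "(\<Sum>j\<in>R. \<Sum>k\<in>UNIV. X k \<tau> i j (R - {j})) + (\<Sum>k\<in>UNIV. Y k \<tau> i R)
       = (\<Sum>k\<in>UNIV. (\<Sum>j\<in>R. X k \<tau> i j (R - {j})) + Y k \<tau> i R)"
      unfolding sum.distrib by (subst sum.swap) simp
    also have "\<dots> \<le> (\<Sum>k\<in>UNIV. (of_bool (\<tau> = s \<and> R = remaining S (d k)) + (\<Sum>l\<in>UNIV. Y k (Suc \<tau>) l R)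
         + (\<Sum>l\<in>UNIV. \<Sum>j\<in>UNIV - R. X k (Suc \<tau>) l j R)) / ?n)"
      by (intro sum_mono cons \<tau>)
    also have "\<dots> = (\<Sum>k\<in>UNIV. y (Suc \<tau>) k R) + (\<Sum>k\<in>UNIV. \<Sum>j\<in>UNIV - R. x (Suc \<tau>) k j R)"
    proof -
      have 1: "(\<Sum>k\<in>UNIV. \<Sum>l\<in>UNIV. Y k (Suc \<tau>) l R) = (\<Sum>l\<in>UNIV. \<Sum>k\<in>UNIV. Y k (Suc \<tau>) l R)"
        by (rule sum.swap)
      have 2: "(\<Sum>k\<in>UNIV. \<Sum>l\<in>UNIV. \<Sum>j\<in>UNIV - R. X k (Suc \<tau>) l j R)
          = (\<Sum>l\<in>UNIV. \<Sum>j\<in>UNIV - R. \<Sum>k\<in>UNIV. X k (Suc \<tau>) l j R)"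
        by (subst sum.swap) (intro sum.cong refl sum.swap)
      show ?thesis
        unfolding dflow[symmetric] x_def y_def
        by (simp add: sum.distrib add_divide_distrib 1 2 flip: sum_divide_distrib)
    qed
    finally show "(\<Sum>j\<in>R. x \<tau> i j (R - {j})) + y \<tau> i R \<le>
       (of_bool (\<tau> = Suc s \<and> R = S) + (\<Sum>k\<in>UNIV. y (Suc \<tau>) k R)
         + (\<Sum>k\<in>UNIV. \<Sum>j\<in>UNIV - R. x (Suc \<tau>) k j R)) / ?n"
      unfolding dbal add.assoc by (simp add: divide_right_mono split del: split_of_bool)
  qed
  moreover have "(of_bool (\<tau> = Suc s \<and> d i = Some j) + (\<Sum>k\<in>UNIV. z k \<tau> i j)) / ?n
      = (\<Sum>R\<in>{R. R \<subseteq> UNIV - {j} \<and> \<tau> - 1 \<le> card R}. x \<tau> i j R)" if \<tau>: "1 \<le> \<tau>" for \<tau> i j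
  proof -
    have "(\<Sum>R\<in>{R. R \<subseteq> UNIV - {j} \<and> \<tau> - 1 \<le> card R}. dx \<tau> i j R)
        = (\<Sum>R\<in>{R. R \<subseteq> UNIV - {j} \<and> \<tau> - 1 \<le> card R}. if S - {j} = R then of_bool (\<tau> = Suc s \<and> d i = Some j) else 0)"
      by (intro sum.cong) (auto simp: dx_def)
    also have "\<dots> = of_bool (\<tau> = Suc s \<and> d i = Some j)"
      using step.prems dS[of i j] by (auto simp: sum.delta' card_Diff_singleton_if)
    finally have 1: "(\<Sum>R\<in>{R. R \<subseteq> UNIV - {j} \<and> \<tau> - 1 \<le> card R}. dx \<tau> i j R) = of_bool (\<tau> = Suc s \<and> d i = Some j)" .
    have "(\<Sum>k\<in>UNIV. z k \<tau> i j) = (\<Sum>R\<in>{R. R \<subseteq> UNIV - {j} \<and> \<tau> - 1 \<le> card R}. \<Sum>k\<in>UNIV. X k \<tau> i j R)"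
      unfolding zX[OF \<tau>] by (rule sum.swap)
    then show ?thesis
      by (simp only: x_def sum.distrib 1 flip: sum_divide_distrib)
  qed
  ultimately show ?case
    by blast
qed

text \<open>A flow started at \<open>UNIV\<close> with n stages is a feasible policy, since its
  values vanish wherever the system truncates. Policies thus supply points of the
  polyhedron.\<close>

lemma outcome_achievable:
  fixes z :: "nat \<Rightarrow> 'i::finite \<Rightarrow> 'j::finite \<Rightarrow> real"
  assumes "outcome CARD('i) UNIV z" and card_j: "CARD('j) = CARD('i)"
  obtains v :: "real ^ ('i \<times> 'j \<times> 'i stage)" where "v \<in> achievable"
    and "\<And>i j s. s \<in> {1..CARD('i)} \<Longrightarrow> coord v i j s = z s i j"
proof -
  obtain x y where fl: "flow CARD('i) (UNIV :: 'j set) x y"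
    and z: "\<And>\<tau> i j. 1 \<le> \<tau> \<Longrightarrow> z \<tau> i j = (\<Sum>R\<in>{R. R \<subseteq> UNIV - {j} \<and> \<tau> - 1 \<le> card R}. x \<tau> i j R)"
    using outcome_flow[OF assms(1)] card_j by auto
  have nn: "0 \<le> x \<tau> i j R" "0 \<le> y \<tau> i R"
    and y0: "\<not> (\<tau> \<le> CARD('i) \<and> \<tau> \<le> card R) \<Longrightarrow> y \<tau> i R = 0"
    and x0: "\<not> (\<tau> \<le> CARD('i) \<and> \<tau> \<le> Suc (card R)) \<Longrightarrow> x \<tau> i j R = 0" for \<tau> i j R
    using fl unfolding flow_def by blast+
  have cons: "(\<Sum>j\<in>R. x s i j (R - {j})) + y s i R \<le>
       (of_bool (s = CARD('i) \<and> R = UNIV) + (\<Sum>k\<in>UNIV. y (Suc s) k R)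
         + (\<Sum>k\<in>UNIV. \<Sum>j\<in>UNIV - R. x (Suc s) k j R)) / real CARD('i)" if "1 \<le> s" for s i R
    using fl that unfolding flow_def by blast
  \<comment> \<open>The system omits y at stage 1, whereas \<open>flow\<close> counts it; omitting a
    nonnegative term keeps the inequality.\<close>
  have drop: "y s i R * of_bool (s \<noteq> 1) \<le> y s i R" for s i R
    using nn(2)[of s i R] by (cases "s = 1") auto
  have "feasible_policy x y"
    unfolding feasible_policy_def Let_def
  proof (intro conjI allI impI ballI)
    show "0 \<le> x t i j S" for t i j S
      by (rule nn)
    show "0 \<le> y t i S" for t i S
      by (rule nn)
    show "(\<Sum>j\<in>UNIV. x CARD('i) i j (UNIV - {j})) + y CARD('i) i UNIV \<le> 1 / real CARD('i)" for i
      using cons[of "CARD('i)" i UNIV] x0[of "Suc CARD('i)"] y0[of "Suc CARD('i)"] by (simp add: Suc_leI)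
    show "(\<Sum>j\<in>S. x t i j (S - {j})) + y t i S * of_bool (t \<noteq> 1)
        - 1 / real CARD('i) * of_bool (t < card S) * (\<Sum>k\<in>UNIV. y (t + 1) k S)
        - 1 / real CARD('i) * (\<Sum>k\<in>UNIV. \<Sum>j\<in>UNIV - S. x (t + 1) k j S) \<le> 0"
      if "t \<in> {1..CARD('i) - 1}" "S \<noteq> {} \<and> S \<subset> UNIV \<and> t \<le> card S" for t i S
    proof -
      \<comment> \<open>By the support condition, a nonzero discard in stage t + 1 has at least t +
        1 available ads, so the indicator changes nothing.\<close>
      have e: "of_bool (t < card S) * (\<Sum>k\<in>UNIV. y (t + 1) k S) = (\<Sum>k\<in>UNIV. y (t + 1) k S)"
        using y0[of "t + 1" S] by (cases "t < card S") auto
      have "(\<Sum>j\<in>S. x t i j (S - {j})) + y t i S \<le> 1 / real CARD('i) * (\<Sum>k\<in>UNIV. y (t + 1) k S)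
          + 1 / real CARD('i) * (\<Sum>k\<in>UNIV. \<Sum>j\<in>UNIV - S. x (t + 1) k j S)"
        using cons[of t i S] that by (simp add: add_divide_distrib psubset_eq)
      then show ?thesis
        unfolding mult.assoc e using drop[of t i S] by linarith
    qed
    show "(\<Sum>j\<in>UNIV. x t i j (UNIV - {j})) + y t i UNIV * of_bool (t \<noteq> 1)
        - 1 / real CARD('i) * (\<Sum>k\<in>UNIV. y (t + 1) k UNIV) \<le> 0"
      if "t \<in> {1..CARD('i) - 1}" for t i
    proof -
      have "t \<noteq> CARD('i)"
        using that zero_less_card_finite[where 'a = 'i] unfolding atLeastAtMost_iff by linarith
      then have "(\<Sum>j\<in>UNIV. x t i j (UNIV - {j})) + y t i UNIV
          \<le> 1 / real CARD('i) * (\<Sum>k\<in>UNIV. y (t + 1) k UNIV)"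
        using cons[of t i UNIV] that by simp
      then show ?thesis
        using drop[of t i UNIV] by linarith
    qed
  qed
  moreover define v :: "real ^ ('i \<times> 'j \<times> 'i stage)"
    where "v = (\<chi> p. case p of (i, j, s) \<Rightarrow> z (Rep_stage s) i j)"
  have vz: "coord v i j s = z s i j" if "s \<in> {1..CARD('i)}" for i j s
    using that by (simp add: coord_def v_def Abs_stage_inverse)
  ultimately have "v \<in> achievable"
    unfolding achievable_def using z by (auto intro!: exI[of _ x] exI[of _ y])
  then show ?thesis
    using vz that by blast
qed

section \<open>Optimal policies of a threshold reward\<close>

text \<open>The inner product of \<open>R^(n^3)\<close> written for functions, so that it applies to
  outcomes directly.\<close>

definition gain :: "(nat \<Rightarrow> 'i::finite \<Rightarrow> 'j::finite \<Rightarrow> real) \<Rightarrow> (nat \<Rightarrow> 'i \<Rightarrow> 'j \<Rightarrow> real) \<Rightarrow> real"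
  where "gain a z = (\<Sum>s=1..CARD('i). \<Sum>i\<in>UNIV. \<Sum>j\<in>UNIV. a s i j * z s i j)"

fun reward :: "(nat \<Rightarrow> 'i \<Rightarrow> 'j \<Rightarrow> real) \<Rightarrow> nat \<Rightarrow> 'i \<Rightarrow> 'j option \<Rightarrow> real" where
  "reward a s i None = 0"
| "reward a s i (Some j) = a s i j"

text \<open>By linearity, a step earns the average over types of immediate reward plus gain of the
  continuation: the recursion of dynamic programming.\<close>

lemma gain_step:
  fixes d :: "'i::finite \<Rightarrow> 'j::finite option"
  assumes "s \<in> {1..CARD('i)}"
  shows "gain a (\<lambda>\<tau> i j. (of_bool (\<tau> = s \<and> d i = Some j) + (\<Sum>k\<in>UNIV. z k \<tau> i j)) / real CARD('i))
       = (\<Sum>k\<in>UNIV. reward a s k (d k) + gain a (z k)) / real CARD('i)"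
proof -
  have "(\<Sum>\<tau>=1..CARD('i). \<Sum>i\<in>UNIV. \<Sum>j\<in>UNIV. a \<tau> i j * of_bool (\<tau> = s \<and> d i = Some j))
      = (\<Sum>\<tau>=1..CARD('i). if \<tau> = s then \<Sum>i\<in>UNIV. reward a s i (d i) else 0)"
  proof (rule sum.cong[OF refl])
    fix \<tau>
    have "(\<Sum>j\<in>UNIV. a s i j * of_bool (d i = Some j)) = reward a s i (d i)" for i
      by (cases "d i") (auto simp: of_bool_def if_distrib cong: if_cong)
    then show "(\<Sum>i\<in>UNIV. \<Sum>j\<in>UNIV. a \<tau> i j * of_bool (\<tau> = s \<and> d i = Some j))
        = (if \<tau> = s then \<Sum>i\<in>UNIV. reward a s i (d i) else 0)"
      by (cases "\<tau> = s") simp_all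
  qed
  also have "\<dots> = (\<Sum>i\<in>UNIV. reward a s i (d i))"
    using assms by simp
  finally have 1: "(\<Sum>\<tau>=1..CARD('i). \<Sum>i\<in>UNIV. \<Sum>j\<in>UNIV. a \<tau> i j * of_bool (\<tau> = s \<and> d i = Some j))
      = (\<Sum>i\<in>UNIV. reward a s i (d i))" .
  have "(\<Sum>k\<in>UNIV. gain a (z k))
      = (\<Sum>\<tau>=1..CARD('i). \<Sum>k\<in>UNIV. \<Sum>i\<in>UNIV. \<Sum>j\<in>UNIV. a \<tau> i j * z k \<tau> i j)"
    unfolding gain_def by (rule sum.swap)
  also have "\<dots> = (\<Sum>\<tau>=1..CARD('i). \<Sum>i\<in>UNIV. \<Sum>j\<in>UNIV. \<Sum>k\<in>UNIV. a \<tau> i j * z k \<tau> i j)"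
    by (rule sum.cong[OF refl], subst sum.swap, rule sum.cong[OF refl], rule sum.swap)
  finally have 2: "(\<Sum>k\<in>UNIV. gain a (z k))
      = (\<Sum>\<tau>=1..CARD('i). \<Sum>i\<in>UNIV. \<Sum>j\<in>UNIV. a \<tau> i j * (\<Sum>k\<in>UNIV. z k \<tau> i j))"
    by (simp add: sum_distrib_left)
  show ?thesis
    unfolding sum.distrib 2 1[symmetric]
    unfolding gain_def times_divide_eq_right distrib_left sum_divide_distrib[symmetric] sum.distrib ..
qed

text \<open>\<open>\<omega> s i\<close> is the reward for matching type \<open>i\<close> to an ad of \<open>J\<close> in stage \<open>s\<close>; \<open>c u\<close> is the value of having
  a \<open>(u+1)\<close>-st ad of \<open>J\<close> (when enough stages remain).\<close>
locale threshold =
  fixes J :: "'j::finite set" and h t :: nat and c :: "nat \<Rightarrow> real"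
    and \<omega> :: "nat \<Rightarrow> 'i::finite \<Rightarrow> real"
  assumes card_j: "CARD('j) = CARD('i)" and card_J: "card J = h" and h_pos: "1 \<le> h"
    and t_pos: "1 \<le> t" and t_h: "t + h \<le> CARD('i)"
    and c_nonneg: "\<And>u. 0 \<le> c u" and c_antimono: "\<And>u v. u \<le> v \<Longrightarrow> v < h \<Longrightarrow> c v \<le> c u"
    and \<omega>_nonneg: "\<And>s i. 0 \<le> \<omega> s i"
    and \<omega>_before: "\<And>s i. s < t \<Longrightarrow> \<omega> s i = 0"
    and \<omega>_sum: "\<And>s. t \<le> s \<Longrightarrow> s < t + h \<Longrightarrow> (\<Sum>i\<in>UNIV. \<omega> s i) = real CARD('i) * c (s - t)"
    and \<omega>_value: "\<And>s i. t < s \<Longrightarrow> \<omega> s i \<noteq> 0 \<Longrightarrow> \<omega> s i = c (min (s - t) h - 1)"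
    and \<omega>_idle: "\<And>s. s < t + h \<Longrightarrow> \<exists>i. \<omega> s i = 0"
    and \<omega>_active: "\<And>s. t \<le> s \<Longrightarrow> \<exists>i. \<omega> s i \<noteq> 0"
    and \<omega>_late: "\<And>s i. t + h \<le> s \<Longrightarrow> \<omega> s i \<noteq> 0"
    and \<omega>_first: "\<And>i i'. \<omega> t i \<noteq> 0 \<Longrightarrow> \<omega> t i' \<noteq> 0 \<Longrightarrow> i = i'"
begin

definition w :: "nat \<Rightarrow> 'i \<Rightarrow> 'j \<Rightarrow> real"
  where "w s i j = of_bool (j \<in> J) * \<omega> s i"

text \<open>Only the \<open>Suc s - t\<close> stages from s down to t can reward an ad of J.
  Truncated subtraction gives the value 0 for s < t.\<close>

definition \<Phi> :: "nat \<Rightarrow> 'j set \<Rightarrow> real"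
  where "\<Phi> s S = (\<Sum>u<min (card (S \<inter> J)) (Suc s - t). c u)"

text \<open>After stage s only \<open>s - t\<close> stages can reward an ad of J. If more ads of J
  are available, one can be spent on type i without loss; otherwise discarding is optimal.\<close>

definition B :: "nat \<Rightarrow> 'i \<Rightarrow> 'j set \<Rightarrow> real"
  where "B s i S = \<Phi> (s - 1) S + (if s - t < card (S \<inter> J) then \<omega> s i else 0)"

text \<open>\<open>B s i S\<close> is the optimal value of the state once type \<open>i\<close> has appeared, so \<open>tight\<close> decisions are the
  optimal ones.\<close>
definition tight :: "nat \<Rightarrow> 'i \<Rightarrow> 'j set \<Rightarrow> 'j option \<Rightarrow> bool"
  where "tight s i S d \<longleftrightarrow> set_option d \<subseteq> S \<and> reward w s i d + \<Phi> (s - 1) (remaining S d) = B s i S"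

lemma card_Int_J: "card (S \<inter> J) \<le> h"
  using card_J card_mono[of J "S \<inter> J"] by simp

lemma card_remove_J: "j \<in> S \<Longrightarrow> j \<in> J \<Longrightarrow> card ((S - {j}) \<inter> J) = card (S \<inter> J) - 1"
  by (simp add: Diff_Int_distrib2 card_Diff_singleton)

lemma card_Int_J_pos: "j \<in> S \<Longrightarrow> j \<in> J \<Longrightarrow> 0 < card (S \<inter> J)"
  by (auto simp: card_gt_0_iff)

lemma \<Phi>_remove_outside: "j \<notin> J \<Longrightarrow> \<Phi> s (S - {j}) = \<Phi> s S"
  by (simp add: \<Phi>_def Diff_Int_distrib2)

lemma \<Phi>_remove_excess:
  assumes "1 \<le> s" "j \<in> S" "j \<in> J" "s - t < card (S \<inter> J)"
  shows "\<Phi> (s - 1) (S - {j}) = \<Phi> (s - 1) S"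
proof -
  have "min (card (S \<inter> J) - 1) (s - t) = s - t" "min (card (S \<inter> J)) (s - t) = s - t"
    using assms by linarith+
  then show ?thesis
    using assms by (simp add: \<Phi>_def card_remove_J)
qed

lemma \<Phi>_remove_deficient:
  assumes "1 \<le> s" "j \<in> S" "j \<in> J" "card (S \<inter> J) \<le> s - t"
  shows "\<Phi> (s - 1) S = \<Phi> (s - 1) (S - {j}) + c (card (S \<inter> J) - 1)"
proof -
  obtain k where "card (S \<inter> J) = Suc k"
    using card_Int_J_pos[OF assms(2,3)] gr0_implies_Suc by blast
  with assms show ?thesis
    by (simp add: \<Phi>_def card_remove_J min_def)
qed

lemma \<Phi>_nonneg: "0 \<le> \<Phi> s S"
  by (simp add: \<Phi>_def sum_nonneg c_nonneg)

lemma discard_bound: "\<Phi> (s - 1) S \<le> B s i S"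
  by (simp add: B_def \<omega>_nonneg)

text \<open>Giving up a scarce ad of J costs \<open>c (card (S \<inter> J) - 1)\<close>. A nonzero
  reward is \<open>c (min (s - t) h - 1)\<close>, which is no larger because c is
  decreasing.\<close>

lemma match_bound:
  assumes s: "1 \<le> s" and j: "j \<in> S"
  shows "w s i j + \<Phi> (s - 1) (S - {j}) \<le> B s i S"
proof (cases "j \<in> J")
  case False
  then show ?thesis
    using discard_bound[of s S i] by (simp add: w_def \<Phi>_remove_outside)
next
  case True
  show ?thesis
  proof (cases "s - t < card (S \<inter> J)")
    case excess: True
    then show ?thesis
      using \<Phi>_remove_excess[OF s j True] True by (simp add: w_def B_def)
  next
    case False
    have "0 < card (S \<inter> J)"
      using card_Int_J_pos j True by blast
    then have "t < s" "card (S \<inter> J) - 1 \<le> min (s - t) h - 1" "min (s - t) h - 1 < h"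
      using False card_Int_J[of S] h_pos by auto
    then have "\<omega> s i \<le> c (card (S \<inter> J) - 1)"
      using \<omega>_value[of s i] c_nonneg c_antimono by metis
    then show ?thesis
      using \<Phi>_remove_deficient[OF s j True] True False by (simp add: w_def B_def)
  qed
qed

text \<open>For t \<le> s and more than \<open>s - t\<close> ads of J, the rewards of all types add
  up to n times the increment \<open>c (s - t)\<close> of \<open>\<Phi>\<close>. Otherwise
  \<open>\<Phi>\<close> does not change and no reward enters \<open>B\<close>.\<close>

lemma average_bound:
  assumes s: "1 \<le> s"
  shows "(\<Sum>i\<in>UNIV. B s i S) = real CARD('i) * \<Phi> s S"
proof -
  consider "s < t" | "t \<le> s" "s - t < card (S \<inter> J)" | "t \<le> s" "card (S \<inter> J) \<le> s - t"
    by linarith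
  then show ?thesis
  proof cases
    case 1
    then show ?thesis
      by (simp add: B_def \<Phi>_def \<omega>_before cong: if_cong)
  next
    case 2
    then have "s < t + h"
      using card_Int_J[of S] by linarith
    moreover have "\<Phi> s S = \<Phi> (s - 1) S + c (s - t)"
      using 2 s by (simp add: \<Phi>_def Suc_diff_le)
    ultimately show ?thesis
      using 2 \<omega>_sum[of s] by (simp add: B_def sum.distrib distrib_left)
  next
    case 3
    then have "\<Phi> s S = \<Phi> (s - 1) S"
      using s by (simp add: \<Phi>_def min_def)
    with 3 show ?thesis
      by (simp add: B_def)
  qed
qed

lemma tight_discard: "card (S \<inter> J) \<le> s - t \<or> \<omega> s i = 0 \<Longrightarrow> tight s i S None"
  by (auto simp: tight_def B_def)

lemma tight_match_excess:
  "1 \<le> s \<Longrightarrow> j \<in> S \<Longrightarrow> j \<in> J \<Longrightarrow> s - t < card (S \<inter> J) \<Longrightarrow> tight s i S (Some j)"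
  using \<Phi>_remove_excess[of s j S] by (simp add: tight_def B_def w_def)

text \<open>The case of equality in \<open>match_bound\<close>: the reward is exactly the value of
  the ad given up.\<close>

lemma tight_match_deficient:
  assumes "t < s" "j \<in> S" "j \<in> J" "card (S \<inter> J) = min (s - t) h" "\<omega> s i \<noteq> 0"
  shows "tight s i S (Some j)"
  using assms \<omega>_value[of s i] \<Phi>_remove_deficient[of s j S]
  by (simp add: tight_def B_def w_def)

lemma tight_exists:
  assumes "1 \<le> s"
  shows "\<exists>d. tight s i S d"
proof (cases "s - t < card (S \<inter> J)")
  case True
  then have "S \<inter> J \<noteq> {}"
    by auto
  then obtain j where "j \<in> S \<inter> J"
    by blast
  then show ?thesis
    using True tight_match_excess assms by blast
next
  case False
  then show ?thesis
    using tight_discard by (meson not_less)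
qed

definition opt :: "nat \<Rightarrow> 'j set \<Rightarrow> (nat \<Rightarrow> 'i \<Rightarrow> 'j \<Rightarrow> real) \<Rightarrow> bool"
  where "opt s S z \<longleftrightarrow> outcome s S z \<and> gain w z = \<Phi> s S"

text \<open>Bellman's principle: \<open>B\<close> averages to \<open>\<Phi>\<close>, so tight
  decisions followed by optimal continuations are optimal. The gain is recorded for every
  functional, not only for \<open>w\<close>.\<close>

lemma opt_step:
  assumes s: "s \<in> {1..CARD('i)}" and d: "\<And>i. tight s i S (d i)"
    and z: "\<And>i. opt (s - 1) (remaining S (d i)) (z i)"
  shows "\<exists>z'. opt s S z' \<and> (\<forall>a. gain a z' = (\<Sum>i\<in>UNIV. reward a s i (d i) + gain a (z i)) / real CARD('i))"
proof -
  define z' where "z' = (\<lambda>\<tau> i j. (of_bool (\<tau> = s \<and> d i = Some j) + (\<Sum>k\<in>UNIV. z k \<tau> i j)) / real CARD('i))"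
  have g: "gain a z' = (\<Sum>i\<in>UNIV. reward a s i (d i) + gain a (z i)) / real CARD('i)" for a
    unfolding z'_def by (rule gain_step[OF s])
  have "outcome s S z'"
    using outcome.step[of d S "s - 1" z] d z s by (simp add: z'_def tight_def opt_def)
  moreover have "gain w z' = \<Phi> s S"
  proof -
    have "(\<Sum>i\<in>UNIV. reward w s i (d i) + gain w (z i)) = (\<Sum>i\<in>UNIV. B s i S)"
      using d z by (intro sum.cong) (auto simp: tight_def opt_def)
    then show ?thesis
      using s by (simp add: g average_bound)
  qed
  ultimately show ?thesis
    using g opt_def by blast
qed

lemma opt_exists: "s \<le> CARD('i) \<Longrightarrow> \<exists>z. opt s S z"
proof (induction s arbitrary: S)
  case 0
  show ?case
    using outcome.stop[of S] t_pos by (auto simp: opt_def gain_def \<Phi>_def)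
next
  case (Suc s)
  have "\<forall>i. \<exists>d. tight (Suc s) i S d"
    using tight_exists by simp
  then obtain d where d: "\<And>i. tight (Suc s) i S (d i)"
    by metis
  have "\<forall>i. \<exists>z. opt s (remaining S (d i)) z"
    using Suc by simp
  then obtain z where "\<And>i. opt s (remaining S (d i)) (z i)"
    by metis
  then show ?case
    using opt_step[of "Suc s" S d z] d Suc.prems by auto
qed

end

section \<open>Linear functionals that are constant on optimal policies\<close>

locale threshold_functional = threshold J h t c \<omega>
  for J :: "'j::finite set" and h t :: nat and c :: "nat \<Rightarrow> real"
    and \<omega> :: "nat \<Rightarrow> 'i::finite \<Rightarrow> real" +
  fixes a :: "nat \<Rightarrow> 'i \<Rightarrow> 'j \<Rightarrow> real" and v :: real
  assumes const_gain: "\<And>z. opt CARD('i) UNIV z \<Longrightarrow> gain a z = v"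
begin

text \<open>The chosen optimal continuation is immaterial in the states called \<open>flat\<close>
  below.\<close>

definition W :: "nat \<Rightarrow> 'j set \<Rightarrow> real"
  where "W s S = gain a (SOME z. opt s S z)"

definition flat :: "nat \<Rightarrow> 'j set \<Rightarrow> bool"
  where "flat s S \<longleftrightarrow> s \<le> CARD('i) \<and> (\<forall>z. opt s S z \<longrightarrow> gain a z = W s S)"

lemma flat_start: "flat CARD('i) UNIV"
  using const_gain opt_exists[of "CARD('i)" UNIV] unfolding flat_def W_def by (metis le_refl someI_ex)

lemma flat_opt_sum:
  assumes "flat s S" "1 \<le> s" "\<And>i. tight s i S (d i)" "\<And>i. opt (s - 1) (remaining S (d i)) (z i)"
  shows "(\<Sum>i\<in>UNIV. reward a s i (d i) + gain a (z i)) = real CARD('i) * W s S"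
proof -
  obtain z' where "opt s S z'"
    "gain a z' = (\<Sum>i\<in>UNIV. reward a s i (d i) + gain a (z i)) / real CARD('i)"
    using opt_step[of s S d z] assms by (auto simp: flat_def)
  then show ?thesis
    using assms(1) by (simp add: flat_def)
qed

lemma opt_some: "s \<le> CARD('i) \<Longrightarrow> opt s S (SOME z. opt s S z)"
  using opt_exists someI_ex by metis

lemma flat_sum:
  assumes "flat s S" "1 \<le> s" "\<And>i. tight s i S (d i)"
  shows "(\<Sum>i\<in>UNIV. reward a s i (d i) + W (s - 1) (remaining S (d i))) = real CARD('i) * W s S"
  unfolding W_def[of "s - 1"] using assms
  by (intro flat_opt_sum opt_some) (auto simp: flat_def)

text \<open>Take two optimal policies that differ only in the decision for type i and in what
  follows it. Their gains under \<open>a\<close> agree, and all other terms cancel.\<close>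

lemma flat_choice_opt:
  assumes fl: "flat s S" "1 \<le> s" and d: "tight s i S d" "opt (s - 1) (remaining S d) z"
    and d': "tight s i S d'" "opt (s - 1) (remaining S d') z'"
  shows "reward a s i d + gain a z = reward a s i d' + gain a z'"
proof -
  have "\<forall>k. \<exists>d. tight s k S d"
    using tight_exists[OF fl(2)] by simp
  then obtain d0 where d0: "\<And>k. tight s k S (d0 k)"
    by metis
  define z0 where "z0 k = (SOME z. opt (s - 1) (remaining S (d0 k)) z)" for k
  have z0: "opt (s - 1) (remaining S (d0 k)) (z0 k)" for k
    unfolding z0_def using fl by (intro opt_some) (auto simp: flat_def)
  have sum: "(\<Sum>k\<in>UNIV. reward a s k ((d0(i := e)) k) + gain a ((z0(i := y)) k))
      = reward a s i e + gain a y + (\<Sum>k\<in>UNIV - {i}. reward a s k (d0 k) + gain a (z0 k))" for e y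
    by (subst sum.remove[of _ i]) (auto intro!: sum.cong)
  have "(\<Sum>k\<in>UNIV. reward a s k ((d0(i := d)) k) + gain a ((z0(i := z)) k)) = real CARD('i) * W s S"
    using d d0 z0 by (intro flat_opt_sum fl) auto
  moreover have "(\<Sum>k\<in>UNIV. reward a s k ((d0(i := d')) k) + gain a ((z0(i := z')) k)) = real CARD('i) * W s S"
    using d' d0 z0 by (intro flat_opt_sum fl) auto
  ultimately show ?thesis
    unfolding sum by linarith
qed

text \<open>Compare two continuations after the same decision: the immediate rewards cancel.\<close>

lemma flat_next:
  assumes "flat s S" "1 \<le> s" "tight s i S d"
  shows "flat (s - 1) (remaining S d)"
proof -
  have "s - 1 \<le> CARD('i)"
    using assms(1) by (auto simp: flat_def)
  then show ?thesis
    using flat_choice_opt[OF assms(1,2,3) _ assms(3) opt_some] by (auto simp: flat_def W_def)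
qed

lemma flat_choice:
  assumes "flat s S" "1 \<le> s" "tight s i S d" "tight s i S d'"
  shows "reward a s i d + W (s - 1) (remaining S d) = reward a s i d' + W (s - 1) (remaining S d')"
proof -
  have "s - 1 \<le> CARD('i)"
    using assms(1) by (auto simp: flat_def)
  then show ?thesis
    unfolding W_def using flat_choice_opt[OF assms(1,2,3) opt_some assms(4) opt_some] by blast
qed

text \<open>A policy for fewer ads can also be followed with more ads available.\<close>
lemma W_subset:
  assumes "flat s S" "S' \<subseteq> S" "\<Phi> s S' = \<Phi> s S"
  shows "W s S' = W s S"
proof -
  have "opt s S' (SOME z. opt s S' z)"
    using assms(1) by (intro opt_some) (simp add: flat_def)
  then have "opt s S (SOME z. opt s S' z)"
    using assms outcome_mono by (auto simp: opt_def)
  then show ?thesis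
    using assms(1) by (simp add: flat_def W_def)
qed

text \<open>By the bound on m, the stages from m down to t suffice for the ads of J in S, so
  discarding every type in stages s down to m + 1 is optimal.\<close>

lemma flat_idle:
  assumes "m \<le> s" "flat s S" "card (S \<inter> J) + t \<le> Suc m"
  shows "flat m S \<and> W m S = W s S"
  using assms
proof (induction rule: dec_induct)
  case base
  then show ?case
    by simp
next
  case (step s)
  have tight: "tight (Suc s) i S None" for i
    using step by (intro tight_discard) auto
  have "flat s S"
    using flat_next[OF step.prems(1) _ tight] by simp
  moreover have "W (Suc s) S = W s S"
    using flat_sum[OF step.prems(1), of "\<lambda>_. None"] tight by simp
  ultimately show ?case
    using step by simp
qed

text \<open>In every stage some type can be discarded optimally: an unrewarded one before stage t +
  h, and any type from then on, as at least h stages from t onward still follow.\<close>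

lemma flat_UNIV: "s \<le> CARD('i) \<Longrightarrow> flat s UNIV"
proof (induction rule: inc_induct)
  case base
  show ?case
    by (rule flat_start)
next
  case (step s)
  obtain i where "tight (Suc s) i UNIV None"
  proof (cases "Suc s < t + h")
    case True
    then show ?thesis
      using \<omega>_idle tight_discard that by blast
  next
    case False
    then have "card (UNIV \<inter> J) \<le> Suc s - t"
      using card_J by simp
    then show ?thesis
      using tight_discard that by blast
  qed
  then show ?case
    using flat_next[OF step.IH] by fastforce
qed

text \<open>Such a state is reached from \<open>UNIV\<close> by matching one ad of J to a rewarded
  type in each stage from t + h down to s + 1. The induction climbs back along this path.\<close>

lemma flat_deficient:
  assumes "t \<le> s" "s \<le> CARD('i)" "- J \<subseteq> S" "card (S \<inter> J) = min (s - t) h"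
  shows "flat s S"
  using assms
proof (induction "t + h - s" arbitrary: s S rule: less_induct)
  case less
  show ?case
  proof (cases "t + h \<le> s")
    case True
    then have "card (S \<inter> J) = card J"
      using less.prems card_J by simp
    then have "S \<inter> J = J"
      by (intro card_subset_eq) auto
    then have "S = UNIV"
      using less.prems by blast
    then show ?thesis
      using flat_UNIV less.prems by simp
  next
    case False
    then have "card (S \<inter> J) < card J"
      using less.prems card_J by simp
    then obtain j where j: "j \<in> J" "j \<notin> S"
      by (metis inf.absorb2 less_irrefl subsetI)
    have card: "card (insert j S \<inter> J) = min (Suc s - t) h"
      using j False less.prems by (simp add: Int_insert_left)
    then have "flat (Suc s) (insert j S)"
      using False less.prems t_h by (intro less.hyps) auto
    moreover obtain i where "\<omega> (Suc s) i \<noteq> 0"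
      using \<omega>_active less.prems le_SucI by blast
    then have "tight (Suc s) i (insert j S) (Some j)"
      using j card less.prems by (intro tight_match_deficient) auto
    ultimately show ?thesis
      using flat_next[of "Suc s" "insert j S" i "Some j"] j by simp
  qed
qed

text \<open>Discarding and matching j are both optimal, and the loss of j does not affect
  \<open>W\<close>.\<close>

lemma coefficient_neutral:
  assumes "flat s S" "1 \<le> s" "j \<in> S" "tight s i S None" "w s i j = 0" "\<Phi> (s - 1) (S - {j}) = \<Phi> (s - 1) S"
  shows "a s i j = 0"
proof -
  have "tight s i S (Some j)"
    using assms by (simp add: tight_def)
  then have "a s i j + W (s - 1) (S - {j}) = W (s - 1) S"
    using flat_choice[OF assms(1,2) _ assms(4), of "Some j"] by simp
  moreover have "W (s - 1) (S - {j}) = W (s - 1) S"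
    using assms flat_next[OF assms(1,2,4)] by (intro W_subset) auto
  ultimately show ?thesis
    by simp
qed

lemma coefficient_zero:
  assumes s: "s \<in> {1..CARD('i)}" and w0: "w s i j = 0"
  shows "a s i j = 0"
proof (cases "\<omega> s i = 0")
  case True
  have "s < t + h"
    using \<omega>_late True not_less by blast
  then have "s - t < card (UNIV \<inter> J)"
    using card_J h_pos by simp
  then have "\<Phi> (s - 1) (UNIV - {j}) = \<Phi> (s - 1) UNIV"
    using s \<Phi>_remove_excess[of s j UNIV] \<Phi>_remove_outside by (cases "j \<in> J") auto
  then show ?thesis
    using s w0 True by (intro coefficient_neutral[OF flat_UNIV] tight_discard) auto
next
  case False
  then have j: "j \<notin> J" and "t \<le> s"
    using w0 \<omega>_before[of s i] by (auto simp: w_def intro: leI)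
  \<comment> \<open>With only \<open>min (s - t) h\<close> ads of J left, discarding is optimal even
    for a rewarded type.\<close>
  obtain T where T: "T \<subseteq> J" "card T = min (s - t) h"
    using obtain_subset_with_card_n[of "min (s - t) h" J] card_J by auto
  then have "(- J \<union> T) \<inter> J = T"
    by blast
  then have card: "card ((- J \<union> T) \<inter> J) = min (s - t) h"
    using T by simp
  then have "flat s (- J \<union> T)"
    using s \<open>t \<le> s\<close> by (intro flat_deficient) auto
  then show ?thesis
    using s w0 j card by (intro coefficient_neutral[of s "- J \<union> T"] tight_discard \<Phi>_remove_outside) auto
qed

text \<open>After idling, the comparison of discarding and matching takes place in stage \<open>m\<close>, where \<open>S\<close> has one more
  ad of \<open>J\<close> than can be of use later; hence matching \<open>j\<close> for every type is optimal there.\<close>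
lemma coefficient_recursion:
  assumes s: "t < s" "s \<le> CARD('i)" and j: "j \<in> J" and \<omega>: "\<omega> s i \<noteq> 0"
  defines "m \<equiv> t + min (s - t) h - 1"
  shows "a s i j = (\<Sum>k\<in>UNIV. a m k j) / real CARD('i)"
proof -
  define k where "k = min (s - t) h"
  have k: "1 \<le> k" "k \<le> h" "k \<le> s - t" and m: "m = t + k - 1"
    using s h_pos by (auto simp: k_def m_def)
  have "k - 1 \<le> card (J - {j})"
    using k card_J j by (simp add: card_Diff_singleton)
  then obtain T where T: "T \<subseteq> J - {j}" "card T = k - 1"
    by (rule obtain_subset_with_card_n)
  \<comment> \<open>All ads outside J, and k ads of J including j: here both discarding i and
    matching it to j are optimal.\<close>
  define S where "S = - J \<union> insert j T"
  have "S \<inter> J = insert j T"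
    using T j by (auto simp: S_def)
  moreover have "j \<notin> T"
    using T by blast
  ultimately have card: "card (S \<inter> J) = k"
    using T k by simp
  have jS: "j \<in> S"
    by (simp add: S_def)
  have s1: "1 \<le> s"
    using s by simp
  have fl: "flat s S"
    using s card by (intro flat_deficient) (auto simp: S_def k_def)
  have discard: "tight s i S None"
    using card k by (intro tight_discard) simp
  have match: "tight s i S (Some j)"
    using s jS j card \<omega> by (intro tight_match_deficient) (auto simp: k_def)
  have "a s i j = W (s - 1) S - W (s - 1) (S - {j})"
    using flat_choice[OF fl s1 discard match] by simp
  \<comment> \<open>Here k + t = \<open>Suc m\<close>, so idling is optimal down to stage m.\<close>
  moreover have "flat m S \<and> W m S = W (s - 1) S"
    using flat_next[OF fl s1 discard] card k s m by (intro flat_idle) auto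
  \<comment> \<open>Without j only k - 1 ads of J remain, which allows idling for one stage
    more.\<close>
  moreover have "W (m - 1) (S - {j}) = W (s - 1) (S - {j})"
  proof -
    have "flat (m - 1) (S - {j}) \<and> W (m - 1) (S - {j}) = W (s - 1) (S - {j})"
      using flat_next[OF fl s1 match] card k s m j jS t_pos
      by (intro flat_idle) (auto simp: card_remove_J)
    then show ?thesis ..
  qed
  moreover have "1 \<le> m" "m - t < card (S \<inter> J)"
    using m k t_pos card by auto
  then have "(\<Sum>i\<in>UNIV. a m i j + W (m - 1) (S - {j})) = real CARD('i) * W m S"
    using flat_sum[of m S "\<lambda>_. Some j"] calculation(2) tight_match_excess jS j by simp
  ultimately have "(\<Sum>i\<in>UNIV. a m i j) = real CARD('i) * a s i j"
    by (simp add: sum.distrib right_diff_distrib)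
  then show ?thesis
    by simp
qed

text \<open>No reward is left after stage t, so \<open>W\<close> does not depend on which ad was
  used.\<close>

lemma coefficient_first:
  assumes "j \<in> J" "j' \<in> J"
  shows "a t i j = a t i j'"
proof -
  have fl: "flat t UNIV" "flat (t - 1) UNIV"
    using t_h by (auto intro: flat_UNIV)
  have "tight t i UNIV (Some l)" if "l \<in> J" for l
    using that t_pos card_J h_pos by (intro tight_match_excess) auto
  then have "a t i j + W (t - 1) (UNIV - {j}) = a t i j' + W (t - 1) (UNIV - {j'})"
    using flat_choice[OF fl(1) t_pos, of i "Some j" "Some j'"] assms by simp
  moreover have "W (t - 1) (UNIV - {l}) = W (t - 1) UNIV" for l
    using t_pos by (intro W_subset fl) (auto simp: \<Phi>_def)
  ultimately show ?thesis
    by simp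
qed

text \<open>Stage t has a single rewarded type, so one number fixes the factor l. Later stages
  follow from \<open>coefficient_recursion\<close>, which \<open>\<omega>\<close> satisfies as well:
  its sum over stage m is n times \<open>c (m - t)\<close>, and \<open>\<omega> s i\<close> is
  \<open>c (m - t)\<close>.\<close>

theorem proportional: "\<exists>l. \<forall>s\<in>{1..CARD('i)}. \<forall>i j. a s i j = l * w s i j"
proof -
  obtain i0 where i0: "\<omega> t i0 \<noteq> 0"
    using \<omega>_active by blast
  obtain j0 where j0: "j0 \<in> J"
    using card_J h_pos by fastforce
  define l where "l = a t i0 j0 / \<omega> t i0"
  have "a s i j = l * w s i j" if "s \<in> {1..CARD('i)}" for s i j
    using that
  proof (induction s arbitrary: i rule: less_induct)
    case (less s)
    show ?case
    proof (cases "w s i j = 0")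
      case True
      then show ?thesis
        using coefficient_zero less.prems by simp
    next
      case False
      then have j: "j \<in> J" and \<omega>: "\<omega> s i \<noteq> 0" and "t \<le> s"
        using \<omega>_before[of s i] by (auto simp: w_def intro: leI)
      show ?thesis
      proof (cases "s = t")
        case True
        then have "i = i0"
          using \<omega> i0 \<omega>_first by blast
        then show ?thesis
          using coefficient_first[OF j j0, of i0] True i0 j by (simp add: l_def w_def)
      next
        case False
        with \<open>t \<le> s\<close> have ts: "t < s"
          by simp
        define m where "m = t + min (s - t) h - 1"
        have m: "m < s" "m \<in> {1..CARD('i)}" "t \<le> m" "m < t + h" "m - t = min (s - t) h - 1"
          using ts h_pos t_pos less.prems by (auto simp: m_def)
        have "a s i j = (\<Sum>k\<in>UNIV. a m k j) / real CARD('i)"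
          unfolding m_def using coefficient_recursion ts less.prems j \<omega> by simp
        also have "(\<Sum>k\<in>UNIV. a m k j) = l * (\<Sum>k\<in>UNIV. \<omega> m k)"
          using less.IH[OF m(1,2)] j by (simp add: w_def sum_distrib_left)
        also have "\<dots> = real CARD('i) * (l * \<omega> s i)"
          using \<omega>_sum[OF m(3,4)] m(5) \<omega>_value[OF ts \<omega>] by simp
        finally show ?thesis
          using j by (simp add: w_def)
      qed
    qed
  qed
  then show ?thesis
    by blast
qed

end

section \<open>The face and its dimension\<close>

text \<open>For p in the hyperplane, the part of p - z0 orthogonal to the directions of F is
  constant on F, hence a multiple of w. It is then orthogonal to p - z0 and so to itself, which
  makes it 0.\<close>

lemma aff_dim_hyperplane_face:
  fixes F :: "'a::euclidean_space set"
  assumes sub: "\<And>z. z \<in> F \<Longrightarrow> w \<bullet> z = b" and ne: "F \<noteq> {}" and "w \<noteq> 0"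
    and uniq: "\<And>a c. (\<And>z. z \<in> F \<Longrightarrow> a \<bullet> z = c) \<Longrightarrow> \<exists>l. a = l *\<^sub>R w"
  shows "aff_dim F = int (DIM('a)) - 1"
proof -
  obtain z0 where z0: "z0 \<in> F"
    using ne by blast
  have "affine hull F = {z. w \<bullet> z = b}"
  proof
    show "affine hull F \<subseteq> {z. w \<bullet> z = b}"
      using sub by (intro hull_minimal) (auto intro: affine_hyperplane)
    show "{z. w \<bullet> z = b} \<subseteq> affine hull F"
    proof
      fix p assume p: "p \<in> {z. w \<bullet> z = b}"
      let ?L = "(+) (- z0) ` F"
      obtain u a where u: "u \<in> span ?L" and a: "\<And>v. v \<in> span ?L \<Longrightarrow> orthogonal a v"
        and pe: "p - z0 = u + a"
        using orthogonal_subspace_decomp_exists[of ?L "p - z0"] by metis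
      have "a \<bullet> z = a \<bullet> z0" if "z \<in> F" for z
        using a[of "- z0 + z"] that by (auto simp: orthogonal_def inner_add_right inner_diff_right intro: span_base)
      then obtain l where "a = l *\<^sub>R w"
        using uniq by blast
      then have "a \<bullet> (p - z0) = 0"
        using p sub[OF z0] by (simp add: inner_diff_right)
      moreover have "a \<bullet> u = 0"
        using a[OF u] by (simp add: orthogonal_def)
      ultimately have "a = 0"
        by (simp add: pe inner_add_right)
      with u pe have "p - z0 \<in> span ?L"
        by simp
      then show "p \<in> affine hull F"
        using affine_hull_span_gen[OF hull_inc[OF z0]] by (force simp: image_iff)
    qed
  qed
  then show ?thesis
    using aff_dim_hyperplane[OF \<open>w \<noteq> 0\<close>, of b] aff_dim_affine_hull[of F] by simp
qed

lemma inner_coord: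
  fixes a z :: "real ^ ('i::finite \<times> 'j::finite \<times> 'i stage)"
  shows "a \<bullet> z = gain (\<lambda>s i j. coord a i j s) (\<lambda>s i j. coord z i j s)"
proof -
  have bij: "bij_betw Abs_stage {1..CARD('i)} (UNIV :: 'i stage set)"
    by (rule bij_betwI[of _ _ _ Rep_stage])
      (use Rep_stage[where 'a = 'i] in \<open>auto simp: Abs_stage_inverse Rep_stage_inverse\<close>)
  have "a \<bullet> z = (\<Sum>(i, j, s)\<in>UNIV \<times> UNIV \<times> UNIV. a $ (i, j, s) * z $ (i, j, s))"
    unfolding inner_vec_def by (rule sum.cong) auto
  also have "\<dots> = (\<Sum>i\<in>UNIV. \<Sum>j\<in>UNIV. \<Sum>s\<in>UNIV. a $ (i, j, s) * z $ (i, j, s))"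
    by (simp only: sum.cartesian_product)
  also have "\<dots> = (\<Sum>i\<in>UNIV. \<Sum>j\<in>UNIV. \<Sum>s=1..CARD('i). coord a i j s * coord z i j s)"
    unfolding coord_def
    by (intro sum.cong refl sum.reindex_bij_betw[OF bij, symmetric])
  also have "\<dots> = (\<Sum>i\<in>UNIV. \<Sum>s=1..CARD('i). \<Sum>j\<in>UNIV. coord a i j s * coord z i j s)"
    by (intro sum.cong refl sum.swap)
  also have "\<dots> = (\<Sum>s=1..CARD('i). \<Sum>i\<in>UNIV. \<Sum>j\<in>UNIV. coord a i j s * coord z i j s)"
    by (rule sum.swap)
  finally show ?thesis
    by (simp add: gain_def)
qed

lemma vec_eq_coord:
  fixes a z :: "real ^ ('i::finite \<times> 'j::finite \<times> 'i stage)"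
  assumes "\<And>s i j. s \<in> {1..CARD('i)} \<Longrightarrow> coord a i j s = coord z i j s"
  shows "a = z"
proof -
  have "a $ (i, j, s) = z $ (i, j, s)" for i j s
    using assms[OF Rep_stage[of s], of i j] by (simp add: coord_def Rep_stage_inverse)
  then show ?thesis
    by (auto simp: vec_eq_iff)
qed

context threshold
begin

definition w_vec :: "real ^ ('i \<times> 'j \<times> 'i stage)"
  where "w_vec = (\<chi> p. case p of (i, j, s) \<Rightarrow> w (Rep_stage s) i j)"

lemma coord_w_vec: "s \<in> {1..CARD('i)} \<Longrightarrow> coord w_vec i j s = w s i j"
  by (simp add: coord_def w_vec_def Abs_stage_inverse)

lemma w_vec_inner: "w_vec \<bullet> z = gain w (\<lambda>s i j. coord z i j s)"
  unfolding inner_coord gain_def by (intro sum.cong refl) (simp add: coord_w_vec)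

lemma w_vec_nonzero: "w_vec \<noteq> 0"
proof -
  obtain i where "\<omega> t i \<noteq> 0"
    using \<omega>_active by blast
  moreover have "J \<noteq> {}"
    using card_J h_pos by auto
  then obtain j where "j \<in> J"
    by blast
  moreover have "t \<in> {1..CARD('i)}"
    using t_pos t_h by simp
  ultimately have "coord w_vec i j t \<noteq> 0"
    by (simp add: coord_w_vec w_def)
  then show ?thesis
    by (auto simp: coord_def)
qed

lemma w_vec_valid:
  assumes "z \<in> achievable"
  shows "w_vec \<bullet> z \<le> \<Phi> CARD('i) UNIV"
proof -
  obtain x y where feas: "feasible_policy x y"
    and z: "\<And>i j s. s \<in> {1..CARD('i)} \<Longrightarrow>
      coord z i j s = (\<Sum>S\<in>{S. S \<subseteq> UNIV - {j} \<and> s - 1 \<le> card S}. x s i j S)"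
    using assms unfolding achievable_def by auto
  have "w_vec \<bullet> z = (\<Sum>s=1..CARD('i). \<Sum>i\<in>UNIV. \<Sum>j\<in>UNIV. w s i j *
      (\<Sum>S\<in>{S. S \<subseteq> UNIV - {j} \<and> s - 1 \<le> card S}. x s i j S))"
    unfolding w_vec_inner gain_def by (intro sum.cong refl) (simp add: z)
  also have "\<dots> \<le> \<Phi> CARD('i) UNIV"
    using t_pos discard_bound match_bound average_bound \<Phi>_nonneg
    by (intro weak_duality[OF feas card_j, where B = B]) (auto simp: \<Phi>_def[of 0])
  finally show ?thesis .
qed

lemma opt_face:
  assumes "opt CARD('i) UNIV z"
  obtains v where "v \<in> achievable" "w_vec \<bullet> v = \<Phi> CARD('i) UNIV"
    "\<And>a. a \<bullet> v = gain (\<lambda>s i j. coord a i j s) z"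
proof -
  obtain v :: "real ^ ('i \<times> 'j \<times> 'i stage)" where v: "v \<in> achievable"
    and coord: "\<And>i j s. s \<in> {1..CARD('i)} \<Longrightarrow> coord v i j s = z s i j"
    using outcome_achievable[of z] assms card_j unfolding opt_def by metis
  have g: "gain a (\<lambda>s i j. coord v i j s) = gain a z" for a
    unfolding gain_def by (intro sum.cong refl) (simp add: coord)
  have "w_vec \<bullet> v = \<Phi> CARD('i) UNIV"
    using assms by (simp add: w_vec_inner g opt_def)
  moreover have "a \<bullet> v = gain (\<lambda>s i j. coord a i j s) z" for a
    by (simp add: inner_coord g)
  ultimately show ?thesis
    using that[OF v] by blast
qed

lemma aff_dim_face:
  "aff_dim {z \<in> achievable. w_vec \<bullet> z = \<Phi> CARD('i) UNIV} = int (CARD('i) ^ 3) - 1"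
proof -
  let ?F = "{z \<in> achievable. w_vec \<bullet> z = \<Phi> CARD('i) UNIV}"
  have "aff_dim ?F = int DIM(real ^ ('i \<times> 'j \<times> 'i stage)) - 1"
  proof (rule aff_dim_hyperplane_face[OF _ _ w_vec_nonzero])
    show "w_vec \<bullet> z = \<Phi> CARD('i) UNIV" if "z \<in> ?F" for z
      using that by simp
    show "?F \<noteq> {}"
      using opt_exists[of "CARD('i)" UNIV] opt_face by blast
    fix a :: "real ^ ('i \<times> 'j \<times> 'i stage)" and v
    assume av: "\<And>z. z \<in> ?F \<Longrightarrow> a \<bullet> z = v"
    \<comment> \<open>Every optimal outcome is realised by a point of the face, so \<open>a\<close>
      is constant on optimal outcomes.\<close>
    interpret threshold_functional J h t c \<omega> "\<lambda>s i j. coord a i j s" v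
    proof
      fix z assume "opt CARD('i) UNIV z"
      then obtain u where u: "u \<in> ?F" and g: "\<And>a. a \<bullet> u = gain (\<lambda>s i j. coord a i j s) z"
        by (rule opt_face) simp
      show "gain (\<lambda>s i j. coord a i j s) z = v"
        using av[OF u] g[of a] by simp
    qed
    obtain l where l: "\<forall>s\<in>{1..CARD('i)}. \<forall>i j. coord a i j s = l * w s i j"
      using proportional by blast
    have "a = l *\<^sub>R w_vec"
    proof (rule vec_eq_coord)
      fix s i j assume s: "s \<in> {1..CARD('i)}"
      then have "coord a i j s = l * coord w_vec i j s"
        using l by (simp add: coord_w_vec)
      then show "coord a i j s = coord (l *\<^sub>R w_vec) i j s"
        by (simp add: coord_def)
    qed
    then show "\<exists>l. a = l *\<^sub>R w_vec" ..
  qed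
  moreover have "DIM(real ^ ('i \<times> 'j \<times> 'i stage)) = CARD('i) ^ 3"
    by (simp add: card_stage card_j power3_eq_cube)
  ultimately show ?thesis
    by (simp only:)
qed

theorem facet_w_vec: "facet_defining achievable (\<lambda>z. w_vec \<bullet> z) (\<Phi> CARD('i) UNIV)"
  unfolding facet_defining_def using w_vec_valid aff_dim_face by blast

end

section \<open>The stated inequality as a threshold reward\<close>

theorem theorem6:
  fixes n h r t :: nat
    and I :: "'i::finite set"
    and J :: "'j::finite set"
    and i :: "nat \<Rightarrow> 'i"
  assumes "CARD('i) = n" and "CARD('j) = n"
    and "card J = h" and "2 \<le> h" and "h \<le> n - 1"
    and "card I = r" and "r \<in> {1..n-1}"
    and "t \<in> {1..n-h}"
  shows "facet_defining (achievable :: (real ^ ('i \<times> 'j \<times> 'i stage)) set)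
    (\<lambda>z. real r * (\<Sum>\<tau>=t+h..n. Zsum z UNIV J \<tau>)
        + real n * Zsum z I J (t + h - 1)
        + (\<Sum>\<tau>=t..t+h-2. real n ^ (t + h - \<tau>) * Zsum z {i \<tau>} J \<tau>))
    (real r + (\<Sum>\<tau>=1..h-1. real n ^ \<tau>))"
proof -
  define c where "c u = (if u < h - 1 then real n ^ (h - 1 - u) else real r)" for u
  \<comment> \<open>The coefficients of the left-hand side at ads of J.\<close>
  define \<omega> where "\<omega> s k = (if s < t then 0 else if s < t + h - 1 then of_bool (k = i s) * real n ^ (t + h - s)
      else if s = t + h - 1 then real n * of_bool (k \<in> I) else real r)" for s k
  have bounds: "1 \<le> t" "t + h \<le> n" "1 \<le> r" "r < n" "3 \<le> n"
    using assms by auto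
  have other: "\<exists>k. k \<noteq> l" for l :: 'i
  proof (rule ccontr)
    assume "\<not> ?thesis"
    then have "UNIV = {l}"
      by auto
    then have "CARD('i) = card {l}"
      by simp
    then show False
      using bounds assms(1) by simp
  qed
  \<comment> \<open>From 1 \<le> r < n: stage t + h - 1 has both a rewarded and an unrewarded
    type.\<close>
  have "I \<noteq> {}" "I \<noteq> UNIV"
    using bounds assms(1,6) by auto
  then have ex_I: "\<exists>k. k \<in> I" and ex_not_I: "\<exists>k. k \<notin> I"
    by blast+
  interpret threshold J h t c \<omega>
  proof
    show "CARD('j) = CARD('i)" "card J = h" "1 \<le> h" "1 \<le> t" "t + h \<le> CARD('i)"
      using assms bounds by auto
    show "0 \<le> c u" for u
      by (simp add: c_def)
    show "c v \<le> c u" if "u \<le> v" "v < h" for u v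
    proof -
      have "real n \<le> real n ^ (h - 1 - u)" if "u < h - 1"
        using self_le_power[of "real n" "h - 1 - u"] bounds that by simp
      then have "real r \<le> real n ^ (h - 1 - u)" if "u < h - 1"
        using that bounds by fastforce
      then show ?thesis
        using that bounds by (auto simp: c_def intro: power_increasing)
    qed
    show "0 \<le> \<omega> s k" for s k
      by (simp add: \<omega>_def)
    show "\<omega> s k = 0" if "s < t" for s k
      using that by (simp add: \<omega>_def)
    show "(\<Sum>k\<in>UNIV. \<omega> s k) = real CARD('i) * c (s - t)" if s: "t \<le> s" "s < t + h" for s
    proof (cases "s = t + h - 1")
      case True
      have "(\<Sum>k\<in>UNIV. of_bool (k \<in> I)) = real r"
        using assms(6) by (simp flip: card_eq_sum add: of_bool_def sum.If_cases)
      then show ?thesis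
        using True s assms(1,4) by (simp add: \<omega>_def c_def flip: sum_distrib_left)
    next
      case False
      \<comment> \<open>The only rewarded type \<open>i s\<close> has weight
        \<open>n ^ (t + h - s)\<close>, which is n times \<open>c (s - t)\<close>.\<close>
      then have "t + h - s = Suc (h - 1 - (s - t))" "s < t + h - 1" "s - t < h - 1"
        using s by auto
      then show ?thesis
        using s assms(1) by (simp add: \<omega>_def c_def of_bool_def flip: sum_distrib_right)
    qed
    \<comment> \<open>Weights are shifted by one against c: \<open>n ^ (t + h - s)\<close> is
      \<open>c (s - t - 1)\<close>, n is \<open>c (h - 2)\<close>, and r is
      \<open>c (h - 1)\<close>.\<close>
    show "\<omega> s k = c (min (s - t) h - 1)" if "t < s" "\<omega> s k \<noteq> 0" for s k
    proof -
      consider "s < t + h - 1" | "s = t + h - 1" | "t + h \<le> s"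
        by linarith
      then show ?thesis
      proof cases
        case 1
        then have "h - 1 - (s - t - 1) = t + h - s" "min (s - t) h = s - t" "s - t - 1 < h - 1"
          using that by auto
        then show ?thesis
          using 1 that by (auto simp: \<omega>_def c_def)
      next
        case 2
        then have "min (s - t) h - 1 = h - 2" "h - 2 < h - 1" "h - 1 - (h - 2) = 1"
          using assms(4) by auto
        then show ?thesis
          using 2 that by (auto simp: \<omega>_def c_def)
      next
        case 3
        then have "min (s - t) h = h"
          by simp
        then show ?thesis
          using 3 assms(4) by (auto simp: \<omega>_def c_def)
      qed
    qed
    show "\<exists>k. \<omega> s k = 0" if "s < t + h" for s
    proof (cases "s = t + h - 1")
      case True
      then show ?thesis
        using ex_not_I by (auto simp: \<omega>_def)
    next
      case False
      then have "s < t + h - 1"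
        using that by linarith
      then show ?thesis
        using other[of "i s"] by (auto simp: \<omega>_def)
    qed
    show "\<exists>k. \<omega> s k \<noteq> 0" if "t \<le> s" for s
    proof (cases "s = t + h - 1")
      case True
      then show ?thesis
        using ex_I bounds that by (auto simp: \<omega>_def)
    next
      case False
      then show ?thesis
        using that bounds by (auto simp: \<omega>_def intro!: exI[of _ "i s"])
    qed
    show "\<omega> s k \<noteq> 0" if "t + h \<le> s" for s k
      using that bounds assms(4) by (auto simp: \<omega>_def)
    \<comment> \<open>Since h \<ge> 2, stage t lies before t + h - 1 and rewards only
      \<open>i t\<close>.\<close>
    show "k = k'" if "\<omega> t k \<noteq> 0" "\<omega> t k' \<noteq> 0" for k k'
      using that assms(4) by (auto simp: \<omega>_def split: if_splits)
  qed
  \<comment> \<open>As t + h \<le> n, there are more than h rewarding stages, so all h terms of c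
    count.\<close>
  have "\<Phi> CARD('i) UNIV = (\<Sum>u<h. c u)"
    using assms(1,3) bounds by (simp add: \<Phi>_def min_absorb1)
  also have "\<dots> = (\<Sum>u<Suc (h - 1). c u)"
    using assms(4) by simp
  also have "\<dots> = real r + (\<Sum>u<h - 1. real n ^ (h - 1 - u))"
    unfolding sum.lessThan_Suc by (simp add: c_def)
  also have "(\<Sum>u<h - 1. real n ^ (h - 1 - u)) = (\<Sum>\<tau>=1..h-1. real n ^ \<tau>)"
    by (rule sum.reindex_bij_witness[where i = "\<lambda>\<tau>. h - 1 - \<tau>" and j = "\<lambda>u. h - 1 - u"]) auto
  finally have rhs: "\<Phi> CARD('i) UNIV = real r + (\<Sum>\<tau>=1..h-1. real n ^ \<tau>)" .
  have lhs: "w_vec \<bullet> z = real r * (\<Sum>\<tau>=t+h..n. Zsum z UNIV J \<tau>)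
        + real n * Zsum z I J (t + h - 1)
        + (\<Sum>\<tau>=t..t+h-2. real n ^ (t + h - \<tau>) * Zsum z {i \<tau>} J \<tau>)" for z
  proof -
    define g where "g s = (\<Sum>k\<in>UNIV. \<omega> s k * (\<Sum>j\<in>J. coord z k j s))" for s
    have "w_vec \<bullet> z = (\<Sum>s=1..n. g s)"
      unfolding w_vec_inner gain_def g_def assms(1)
    proof (intro sum.cong refl)
      fix s k
      have "(\<Sum>j\<in>UNIV. w s k j * coord z k j s) = (\<Sum>j\<in>J. \<omega> s k * coord z k j s)"
        by (rule sum.mono_neutral_cong_right) (auto simp: w_def)
      then show "(\<Sum>j\<in>UNIV. w s k j * coord z k j s) = \<omega> s k * (\<Sum>j\<in>J. coord z k j s)"
        by (simp add: sum_distrib_left)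
    qed
    \<comment> \<open>Stages below t have weight 0.\<close>
    also have "\<dots> = (\<Sum>s\<in>{t+h..n} \<union> ({t+h-1} \<union> {t..t+h-2}). g s)"
      using assms(4) bounds by (intro sum.mono_neutral_right) (auto simp: g_def \<omega>_def)
    also have "\<dots> = (\<Sum>s=t+h..n. g s) + (g (t + h - 1) + (\<Sum>s=t..t+h-2. g s))"
      using assms(4) bounds by (subst sum.union_disjoint; (subst sum.union_disjoint)?) auto
    also have "(\<Sum>s=t+h..n. g s) = real r * (\<Sum>\<tau>=t+h..n. Zsum z UNIV J \<tau>)"
      unfolding sum_distrib_left
    proof (rule sum.cong[OF refl])
      fix s assume "s \<in> {t+h..n}"
      then have "\<omega> s k = real r" for k
        using assms(4) by (auto simp: \<omega>_def)
      then show "g s = real r * Zsum z UNIV J s"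
        by (simp add: g_def Zsum_def sum_distrib_left)
    qed
    also have "g (t + h - 1) = real n * Zsum z I J (t + h - 1)"
    proof -
      have "\<omega> (t + h - 1) k = real n * of_bool (k \<in> I)" for k
        using assms(4) by (auto simp: \<omega>_def)
      then have "g (t + h - 1) = (\<Sum>k\<in>UNIV. real n * of_bool (k \<in> I) * (\<Sum>j\<in>J. coord z k j (t + h - 1)))"
        by (simp add: g_def)
      also have "\<dots> = (\<Sum>k\<in>I. real n * (\<Sum>j\<in>J. coord z k j (t + h - 1)))"
        by (rule sum.mono_neutral_cong_right) auto
      finally show ?thesis
        by (simp add: Zsum_def sum_distrib_left)
    qed
    also have "(\<Sum>s=t..t+h-2. g s) = (\<Sum>\<tau>=t..t+h-2. real n ^ (t + h - \<tau>) * Zsum z {i \<tau>} J \<tau>)"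
    proof (rule sum.cong[OF refl])
      fix s assume "s \<in> {t..t+h-2}"
      then have "t \<le> s" "s < t + h - 1"
        using assms(4) by auto
      then have "\<omega> s k = of_bool (k = i s) * real n ^ (t + h - s)" for k
        by (simp add: \<omega>_def)
      then have "g s = (\<Sum>k\<in>UNIV. of_bool (k = i s) * real n ^ (t + h - s) * (\<Sum>j\<in>J. coord z k j s))"
        by (simp add: g_def)
      also have "\<dots> = (\<Sum>k\<in>{i s}. real n ^ (t + h - s) * (\<Sum>j\<in>J. coord z k j s))"
        by (rule sum.mono_neutral_cong_right) auto
      finally show "g s = real n ^ (t + h - s) * Zsum z {i s} J s"
        by (simp add: Zsum_def)
    qed
    finally show ?thesis
      by (simp only: add.assoc)
  qed
  show ?thesis
    using facet_w_vec unfolding lhs rhs .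
qed

end
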